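(* Let $k,m\in\mathbb{N}$ and $$c_k = \left\lceil \frac{k\ln(k+2)}{k\ln(k+2)-\ln\!\left((k+2)^{k}-\lfloor (k+2)/2\rfloor\, k!\right)}\right\rceil.$$ Then $\chi_{DP}(C_{2m+2}\square K_{k,t}) = k+3$ whenever $$t\geq c_k\left(\frac{P_{DP}(C_{2m+2},k + 2)}{k+2}\right)^k = c_k\left(\frac{(k+1)^{2m+2}-1}{k+2}\right)^k.$$
   Context: $C_n$ is the cycle on $n$ vertices, $K_{k,t}$ the complete bipartite graph with parts of sizes $k$ and $t$, and $\square$ the Cartesian product ($(u,v)\sim(u',v')$ iff $u=u'$ and $vv'$ is an edge, or $v=v'$ and $uu'$ is an edge). A cover of a graph $G$ is a pair $\mathcal{H}=(L,H)$ with $H$ a graph and $L:V(G)\to\mathcal{P}(V(H))$ such that $\{L(v)\}$ partitions $V(H)$ into $|V(G)|$ parts, each $H[L(v)]$ is complete, edges of $H$ between distinct $L(u),L(v)$ occur only if $uv\in E(G)$, and for $uv\in E(G)$ these edges form a (possibly empty) matching; it is $m$-fold if all $|L(v)|=m$. An $\mathcal{H}$-coloring is an independent set of $H$ of size $|V(G)|$. $\chi_{DP}(G)$ is the least $m$ such that every $m$-fold cover admits an $\mathcal{H}$-coloring. $P_{DP}(G,m)$ is the minimum, over all $m$-fold covers $\mathcal{H}$ of $G$, of the number of $\mathcal{H}$-colorings of $G$. *)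

theory Defs
  imports Complex_Main "HOL-Library.Disjoint_Sets"
begin

record 'a ugraph =
  verts :: "'a set"
  edges :: "'a set set"

definition simple_graph :: "'a ugraph \<Rightarrow> bool" where
  "simple_graph G \<longleftrightarrow> finite (verts G) \<and> (\<forall>e\<in>edges G. e \<subseteq> verts G \<and> card e = 2)"

text \<open>The cycle is only meaningful for at least three vertices.\<close>

definition cycle_graph :: "nat \<Rightarrow> nat ugraph" where
  "cycle_graph n = \<lparr>verts = {..<n}, edges = {{i, Suc i mod n} | i. i < n}\<rparr>"

definition complete_bipartite :: "nat \<Rightarrow> nat \<Rightarrow> (nat + nat) ugraph" where
  "complete_bipartite k t =
     \<lparr>verts = Inl ` {..<k} \<union> Inr ` {..<t},
      edges = {{Inl i, Inr j} | i j. i < k \<and> j < t}\<rparr>"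

definition cartesian_product :: "'a ugraph \<Rightarrow> 'b ugraph \<Rightarrow> ('a \<times> 'b) ugraph"
    (infixr \<open>\<box>\<close> 80) where
  "G \<box> H =
     \<lparr>verts = verts G \<times> verts H,
      edges = {{(u, v), (u', v')} | u v u' v'.
                 u = u' \<and> u \<in> verts G \<and> {v, v'} \<in> edges H \<or>
                 v = v' \<and> v \<in> verts H \<and> {u, u'} \<in> edges G}\<rparr>"

definition is_clique :: "'a ugraph \<Rightarrow> 'a set \<Rightarrow> bool" where
  "is_clique G S \<longleftrightarrow> (\<forall>x\<in>S. \<forall>y\<in>S. x \<noteq> y \<longrightarrow> {x, y} \<in> edges G)"

definition independent_set :: "'a ugraph \<Rightarrow> 'a set \<Rightarrow> bool" where
  "independent_set G S \<longleftrightarrow> S \<subseteq> verts G \<and> (\<forall>x\<in>S. \<forall>y\<in>S. {x, y} \<notin> edges G)"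

definition edges_between :: "'a ugraph \<Rightarrow> 'a set \<Rightarrow> 'a set \<Rightarrow> 'a set set" where
  "edges_between G A B = {{x, y} | x y. x \<in> A \<and> y \<in> B \<and> {x, y} \<in> edges G}"

text \<open>A matching is a set of pairwise disjoint edges, expressed by \<^const>\<open>disjoint\<close>.\<close>

definition is_cover :: "'a ugraph \<Rightarrow> ('a \<Rightarrow> 'b set) \<Rightarrow> 'b ugraph \<Rightarrow> bool" where
  "is_cover G L H \<longleftrightarrow>
     simple_graph H \<and>
     partition_on (verts H) (L ` verts G) \<and>
     card (L ` verts G) = card (verts G) \<and>
     (\<forall>v\<in>verts G. is_clique H (L v)) \<and>
     (\<forall>u\<in>verts G. \<forall>v\<in>verts G. u \<noteq> v \<longrightarrow>
        edges_between H (L u) (L v) \<noteq> {} \<longrightarrow> {u, v} \<in> edges G) \<and>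
     (\<forall>u\<in>verts G. \<forall>v\<in>verts G. {u, v} \<in> edges G \<longrightarrow>
        disjoint (edges_between H (L u) (L v)))"

definition is_fold_cover :: "nat \<Rightarrow> 'a ugraph \<Rightarrow> ('a \<Rightarrow> 'b set) \<Rightarrow> 'b ugraph \<Rightarrow> bool" where
  "is_fold_cover m G L H \<longleftrightarrow> is_cover G L H \<and> (\<forall>v\<in>verts G. card (L v) = m)"

definition cover_colorings :: "'a ugraph \<Rightarrow> 'b ugraph \<Rightarrow> 'b set set" where
  "cover_colorings G H = {I. independent_set H I \<and> card I = card (verts G)}"

text \<open>
  In the next two definitions the vertices of covers are taken from the type \<^typ>\<open>nat\<close>. As covers
  are finite graphs this is no restriction; see lemma \<open>fold_cover_nat\<close> below.

  A partition has no empty parts, so a nonempty graph has no 0-fold cover. Hence \<open>m\<close> ranges over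
  the positive integers in the definition of the DP-chromatic number.
\<close>

definition chi_DP :: "'a ugraph \<Rightarrow> nat" where
  "chi_DP G = (LEAST m. 0 < m \<and>
     (\<forall>(L :: 'a \<Rightarrow> nat set) H. is_fold_cover m G L H \<longrightarrow> cover_colorings G H \<noteq> {}))"

definition P_DP :: "'a ugraph \<Rightarrow> nat \<Rightarrow> nat" where
  "P_DP G m = (LEAST n. \<exists>(L :: 'a \<Rightarrow> nat set) H.
     is_fold_cover m G L H \<and> card (cover_colorings G H) = n)"

definition c_const :: "nat \<Rightarrow> int" where
  "c_const k =
     \<lceil>real k * ln (real k + 2) /
       (real k * ln (real k + 2) -
        ln ((real k + 2) ^ k - of_int \<lfloor>(real k + 2) / 2\<rfloor> * fact k))\<rceil>"

lemma fold_cover_nat: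
  fixes G :: "'a ugraph" and L :: "'a \<Rightarrow> 'b set" and H :: "'b ugraph"
  assumes "is_fold_cover m G L H"
  shows "\<exists>(L' :: 'a \<Rightarrow> nat set) H'. is_fold_cover m G L' H' \<and>
           card (cover_colorings G H') = card (cover_colorings G H) \<and>
           (cover_colorings G H' = {} \<longleftrightarrow> cover_colorings G H = {})"
proof -
  have cov: "is_cover G L H" and cardL: "\<And>v. v \<in> verts G \<Longrightarrow> card (L v) = m"
    using assms by (auto simp: is_fold_cover_def)
  have fin: "finite (verts H)" and sg: "\<And>e. e \<in> edges H \<Longrightarrow> e \<subseteq> verts H \<and> card e = 2"
    using cov unfolding is_cover_def simple_graph_def by blast+
  have part: "partition_on (verts H) (L ` verts G)"
    and parts: "card (L ` verts G) = card (verts G)"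
    and clique: "\<And>v. v \<in> verts G \<Longrightarrow> is_clique H (L v)"
    and cross: "\<And>u v. \<lbrakk>u \<in> verts G; v \<in> verts G; u \<noteq> v; edges_between H (L u) (L v) \<noteq> {}\<rbrakk>
      \<Longrightarrow> {u, v} \<in> edges G"
    and matching: "\<And>u v. \<lbrakk>u \<in> verts G; v \<in> verts G; {u, v} \<in> edges G\<rbrakk>
      \<Longrightarrow> disjoint (edges_between H (L u) (L v))"
    using cov unfolding is_cover_def by blast+
  obtain f :: "'b \<Rightarrow> nat" where inj: "inj_on f (verts H)"
    using finite_imp_inj_to_nat_seg[OF fin] by blast
  have sub: "L v \<subseteq> verts H" if "v \<in> verts G" for v
    using part that by (auto simp: partition_on_def)
  define H' where "H' = \<lparr>verts = f ` verts H, edges = (`) f ` edges H\<rparr>"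
  define L' where "L' = (\<lambda>v. f ` L v)"
  have injP: "inj_on ((`) f) (Pow (verts H))"
    using inj by (rule inj_on_image_Pow)
  have edge_iff: "f ` e \<in> edges H' \<longleftrightarrow> e \<in> edges H" if "e \<subseteq> verts H" for e
  proof -
    have "f ` e = f ` e' \<longleftrightarrow> e = e'" if "e' \<in> edges H" for e'
      using inj_on_image_eq_iff[OF inj] sg that \<open>e \<subseteq> verts H\<close> by metis
    then show ?thesis by (auto simp: H'_def)
  qed
  have edge2: "{f x, f y} \<in> edges H' \<longleftrightarrow> {x, y} \<in> edges H"
    if "x \<in> verts H" "y \<in> verts H" for x y
    using edge_iff[of "{x, y}"] that by simp
  have between: "edges_between H' (L' u) (L' v) = (`) f ` edges_between H (L u) (L v)"
    if "u \<in> verts G" "v \<in> verts G" for u v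
  proof -
    have e: "{f x, f y} \<in> edges H' \<longleftrightarrow> {x, y} \<in> edges H" if "x \<in> L u" "y \<in> L v" for x y
      using that sub \<open>u \<in> verts G\<close> \<open>v \<in> verts G\<close> by (intro edge2) auto
    show ?thesis
    proof (intro set_eqI iffI)
      fix a assume "a \<in> edges_between H' (L' u) (L' v)"
      then obtain x y where "x \<in> L u" "y \<in> L v" "a = f ` {x, y}" "{f x, f y} \<in> edges H'"
        unfolding edges_between_def L'_def by auto
      then show "a \<in> (`) f ` edges_between H (L u) (L v)"
        using e unfolding edges_between_def by blast
    next
      fix a assume "a \<in> (`) f ` edges_between H (L u) (L v)"
      then obtain x y where xy: "x \<in> L u" "y \<in> L v" "a = f ` {x, y}" "{x, y} \<in> edges H"
        unfolding edges_between_def by blast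
      then have "a = {f x, f y}" "{f x, f y} \<in> edges H'" using e by auto
      then show "a \<in> edges_between H' (L' u) (L' v)"
        using xy(1,2) unfolding edges_between_def L'_def by blast
    qed
  qed
  have "simple_graph H'"
    using fin sg inj by (auto simp: simple_graph_def H'_def card_image inj_on_subset)
  moreover have L'_img: "L' ` verts G = (`) f ` L ` verts G"
    by (auto simp: L'_def)
  have "partition_on (verts H') (L' ` verts G)"
  proof -
    have "(`) f ` L ` verts G - {{}} = (`) f ` L ` verts G"
      using partition_onD3[OF part] by auto
    then show ?thesis
      using partition_on_inj_image[OF part inj] by (simp add: L'_img H'_def)
  qed
  moreover have "card (L' ` verts G) = card (verts G)"
  proof -
    have "card (L' ` verts G) = card (L ` verts G)"
      unfolding L'_img by (rule card_image, rule inj_on_subset[OF injP]) (use sub in auto)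
    then show ?thesis using parts by simp
  qed
  moreover have "is_clique H' (L' v)" if "v \<in> verts G" for v
  proof -
    have "is_clique H (L v)" using that by (rule clique)
    moreover have "{f x, f y} \<in> edges H' \<longleftrightarrow> {x, y} \<in> edges H" if "x \<in> L v" "y \<in> L v" for x y
      using that sub \<open>v \<in> verts G\<close> by (intro edge2) auto
    ultimately have "{f x, f y} \<in> edges H'" if "x \<in> L v" "y \<in> L v" "f x \<noteq> f y" for x y
      using that unfolding is_clique_def by metis
    then show ?thesis
      unfolding is_clique_def L'_def by blast
  qed
  moreover have "{u, v} \<in> edges G"
    if "u \<in> verts G" "v \<in> verts G" "u \<noteq> v" "edges_between H' (L' u) (L' v) \<noteq> {}" for u v
  proof (rule cross[OF that(1-3)])
    show "edges_between H (L u) (L v) \<noteq> {}"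
      using that(4) unfolding between[OF that(1,2)] by blast
  qed
  moreover have "disjoint (edges_between H' (L' u) (L' v))"
    if "u \<in> verts G" "v \<in> verts G" "{u, v} \<in> edges G" for u v
  proof -
    have d: "disjoint (edges_between H (L u) (L v))"
      using that by (rule matching)
    have s: "e \<subseteq> verts H" if "e \<in> edges_between H (L u) (L v)" for e
      using that sg by (auto simp: edges_between_def)
    show ?thesis
      unfolding between[OF that(1,2)] disjoint_def
    proof (intro ballI impI)
      fix a b assume "a \<in> (`) f ` edges_between H (L u) (L v)"
        "b \<in> (`) f ` edges_between H (L u) (L v)" "a \<noteq> b"
      then obtain a' b' where ab: "a = f ` a'" "b = f ` b'" "a' \<noteq> b'"
        "a' \<in> edges_between H (L u) (L v)" "b' \<in> edges_between H (L u) (L v)" by auto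
      then have "a' \<inter> b' = {}" using d by (auto simp: disjoint_def)
      then show "a \<inter> b = {}"
        using inj_on_image_Int[OF inj s[OF ab(4)] s[OF ab(5)]] ab by simp
    qed
  qed
  ultimately have "is_cover G L' H'" unfolding is_cover_def by (intro conjI ballI impI)
  moreover have "card (L' v) = m" if "v \<in> verts G" for v
    using cardL[OF that] card_image[OF inj_on_subset[OF inj sub[OF that]]] by (simp add: L'_def)
  ultimately have fc: "is_fold_cover m G L' H'" by (simp add: is_fold_cover_def)
  have ind: "independent_set H' (f ` I) \<longleftrightarrow> independent_set H I" if "I \<subseteq> verts H" for I
  proof -
    have "verts H' = f ` verts H" by (simp add: H'_def)
    moreover have "{f x, f y} \<in> edges H' \<longleftrightarrow> {x, y} \<in> edges H" if "x \<in> I" "y \<in> I" for x y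
      using that \<open>I \<subseteq> verts H\<close> by (intro edge2) auto
    ultimately show ?thesis using that unfolding independent_set_def by (simp add: image_mono)
  qed
  have cc: "cover_colorings G H' = (`) f ` cover_colorings G H"
  proof (intro set_eqI iffI)
    fix J assume J: "J \<in> cover_colorings G H'"
    then have "J \<subseteq> f ` verts H" by (auto simp: cover_colorings_def independent_set_def H'_def)
    then obtain I where I: "I \<subseteq> verts H" "J = f ` I" by (meson subset_imageE)
    have "card J = card I" using card_image[OF inj_on_subset[OF inj I(1)]] I(2) by simp
    then have "I \<in> cover_colorings G H"
      using J ind[OF I(1)] I(2) unfolding cover_colorings_def by simp
    then show "J \<in> (`) f ` cover_colorings G H" using I(2) by blast
  next
    fix J assume "J \<in> (`) f ` cover_colorings G H"
    then obtain I where I: "J = f ` I" "independent_set H I" "card I = card (verts G)"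
      unfolding cover_colorings_def by blast
    then have sI: "I \<subseteq> verts H" by (simp add: independent_set_def)
    have "card J = card I" using card_image[OF inj_on_subset[OF inj sI]] I(1) by simp
    then show "J \<in> cover_colorings G H'"
      using I ind[OF sI] unfolding cover_colorings_def by simp
  qed
  have "cover_colorings G H \<subseteq> Pow (verts H)"
    unfolding cover_colorings_def independent_set_def by blast
  then have "card (cover_colorings G H') = card (cover_colorings G H)"
    unfolding cc by (intro card_image inj_on_subset[OF injP])
  moreover have "cover_colorings G H' = {} \<longleftrightarrow> cover_colorings G H = {}"
    unfolding cc by (rule image_is_empty)
  ultimately show ?thesis using fc by (intro exI conjI)
qed

end

theory Submission
  imports Defs
begin

text \<open>
  Write \<open>q = k + 2\<close> and \<open>n = 2 * m + 2\<close>. The product is \<open>(k + 2)\<close>-degenerate, which gives the upper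
  bound \<open>k + 3\<close>. For the lower bound, put on each of the \<open>k\<close> copies of the even cycle the \<open>q\<close>-fold
  cover whose matchings are the identity except for a cyclic shift by one on a single edge. It attains
  \<open>P_DP\<close>, and simultaneous shifts of all labels act freely on its colorings, so that there are
  \<open>(P_DP / q) ^ k\<close> tuples of orbits, each consisting of \<open>q ^ k\<close> tuples of colorings. On each of the \<open>t\<close>
  other copies use the identity except for an involution with \<open>q div 2\<close> transpositions on a single
  edge. If at every vertex of such a copy the same \<open>k\<close> labels are forbidden and the two remaining ones
  are exchanged by the involution, then the copy cannot be colored: the two labels would have to alternate
  along the path with an odd number of edges that is left after removing the special edge. Choosing the matchings between the copies appropriately, one such copy kills
  \<open>(q div 2) * fact k\<close> of the \<open>q ^ k\<close> tuples in a given tuple of orbits, namely those in a translate of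
  a fixed set, and the translate is arbitrary. By averaging, \<open>c_const k\<close> translates chosen greedily
  cover everything.
\<close>

section \<open>Covers and their colorings\<close>

text \<open>Membership in \<open>PiE\<close> fixes the function outside the vertex set, so that
  counting functions counts choices of one element per list.\<close>

definition cover_transversals :: "'a ugraph \<Rightarrow> ('a \<Rightarrow> 'b set) \<Rightarrow> 'b ugraph \<Rightarrow> ('a \<Rightarrow> 'b) set" where
  "cover_transversals G L H =
     {f \<in> PiE (verts G) L. \<forall>u\<in>verts G. \<forall>v\<in>verts G. {f u, f v} \<notin> edges H}"

lemma is_coverD:
  assumes "is_cover G L H"
  shows "simple_graph H"
    and "verts H = \<Union> (L ` verts G)"
    and "disjoint (L ` verts G)"
    and "card (L ` verts G) = card (verts G)"
    and "v \<in> verts G \<Longrightarrow> is_clique H (L v)"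
    and "\<lbrakk>u \<in> verts G; v \<in> verts G; u \<noteq> v; x \<in> L u; y \<in> L v; {x, y} \<in> edges H\<rbrakk>
           \<Longrightarrow> {u, v} \<in> edges G"
    and "\<lbrakk>u \<in> verts G; v \<in> verts G; {u, v} \<in> edges G\<rbrakk>
           \<Longrightarrow> disjoint (edges_between H (L u) (L v))"
proof -
  show "simple_graph H" "verts H = \<Union> (L ` verts G)" "disjoint (L ` verts G)"
    "card (L ` verts G) = card (verts G)"
    using assms by (simp_all add: is_cover_def partition_on_def)
  show "v \<in> verts G \<Longrightarrow> is_clique H (L v)"
    using assms by (simp add: is_cover_def)
  show "\<lbrakk>u \<in> verts G; v \<in> verts G; {u, v} \<in> edges G\<rbrakk> \<Longrightarrow> disjoint (edges_between H (L u) (L v))"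
    using assms by (simp add: is_cover_def)
  assume "u \<in> verts G" "v \<in> verts G" "u \<noteq> v" and e: "x \<in> L u" "y \<in> L v" "{x, y} \<in> edges H"
  moreover have "edges_between H (L u) (L v) \<noteq> {}"
    using e by (auto simp: edges_between_def)
  ultimately show "{u, v} \<in> edges G"
    using assms by (simp add: is_cover_def)
qed

text \<open>Equality of the cardinalities makes \<open>L\<close> injective on the finite vertex set,
  so that disjointness of the family of lists becomes disjointness of the lists at distinct
  vertices.\<close>

lemma cover_lists_disjoint:
  assumes "is_cover G L H" "finite (verts G)" "u \<in> verts G" "v \<in> verts G" "x \<in> L u" "x \<in> L v"
  shows "u = v"
proof -
  have "inj_on L (verts G)"
    using is_coverD(4)[OF assms(1)] assms(2) by (simp add: eq_card_imp_inj_on)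
  moreover have "L u = L v"
    using is_coverD(3)[OF assms(1)] assms(3-6) by (auto simp: disjoint_def)
  ultimately show ?thesis using assms(3,4) by (rule inj_onD)
qed

lemma cover_matching_unique:
  assumes "is_cover G L H" "u \<in> verts G" "v \<in> verts G" "{u, v} \<in> edges G"
    and "x \<in> L u" "y \<in> L v" "y' \<in> L v" "{x, y} \<in> edges H" "{x, y'} \<in> edges H"
  shows "y = y'"
proof -
  have "{x, y} \<in> edges_between H (L u) (L v)" "{x, y'} \<in> edges_between H (L u) (L v)"
    using assms(5-9) by (auto simp: edges_between_def)
  moreover have "{x, y} \<inter> {x, y'} \<noteq> {}" by simp
  ultimately have "{x, y} = {x, y'}"
    using is_coverD(7)[OF assms(1-4)] unfolding disjoint_def by meson
  then show ?thesis by (auto simp: doubleton_eq_iff)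
qed

text \<open>An independent set meets each clique \<open>L v\<close> at most once. With as many
  elements as there are vertices it meets each list exactly once, so it is the range of a unique
  choice function.\<close>

lemma cover_colorings_transversals:
  assumes cov: "is_cover G L H" and fin: "finite (verts G)"
  shows "bij_betw (\<lambda>f. f ` verts G) (cover_transversals G L H) (cover_colorings G H)"
proof -
  note dis = cover_lists_disjoint[OF cov fin]
  have inj: "inj_on (\<lambda>f. f ` verts G) (cover_transversals G L H)"
  proof (rule inj_onI)
    fix f g assume f: "f \<in> cover_transversals G L H" and g: "g \<in> cover_transversals G L H"
      and eq: "f ` verts G = g ` verts G"
    have "f v = g v" if v: "v \<in> verts G" for v
    proof -
      have "f v \<in> g ` verts G" using eq v by blast
      then obtain w where w: "w \<in> verts G" "f v = g w" by blast
      have "f \<in> PiE (verts G) L" "g \<in> PiE (verts G) L"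
        using f g by (simp_all add: cover_transversals_def)
      then have "f v \<in> L v" "g w \<in> L w" using v w(1) by (blast intro: PiE_mem)+
      then have "v = w" using dis[OF v w(1)] w(2) by simp
      then show ?thesis using w by simp
    qed
    then show "f = g"
      using f g by (intro PiE_ext[of f "verts G" L g]) (auto simp: cover_transversals_def)
  qed
  have "f ` verts G \<in> cover_colorings G H" if f: "f \<in> cover_transversals G L H" for f
  proof -
    have fL: "f v \<in> L v" if "v \<in> verts G" for v
      using f that by (auto simp: cover_transversals_def)
    have "inj_on f (verts G)"
    proof (rule inj_onI)
      fix u v assume uv: "u \<in> verts G" "v \<in> verts G" "f u = f v"
      show "u = v" by (rule dis[OF uv(1,2) fL[OF uv(1)]]) (use uv fL in simp)
    qed
    then have "card (f ` verts G) = card (verts G)" by (rule card_image)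
    moreover have "f ` verts G \<subseteq> verts H" using fL is_coverD(2)[OF cov] by auto
    ultimately show ?thesis
      using f by (auto simp: cover_colorings_def independent_set_def cover_transversals_def)
  qed
  moreover have "I \<in> (\<lambda>f. f ` verts G) ` cover_transversals G L H"
    if I: "I \<in> cover_colorings G H" for I
  proof -
    have sub: "I \<subseteq> \<Union> (L ` verts G)"
      and ind: "\<And>x y. x \<in> I \<Longrightarrow> y \<in> I \<Longrightarrow> {x, y} \<notin> edges H"
      and cI: "card I = card (verts G)"
      using I is_coverD(2)[OF cov] by (auto simp: cover_colorings_def independent_set_def)
    have "\<forall>x\<in>I. \<exists>v. v \<in> verts G \<and> x \<in> L v" using sub by blast
    then obtain p where p: "\<And>x. x \<in> I \<Longrightarrow> p x \<in> verts G \<and> x \<in> L (p x)" by metis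
    have "inj_on p I"
    proof (rule inj_onI)
      fix x y assume xy: "x \<in> I" "y \<in> I" "p x = p y"
      then have "x \<in> L (p x)" "y \<in> L (p x)" "is_clique H (L (p x))"
        using p is_coverD(5)[OF cov] by force+
      then show "x = y" using ind[OF xy(1,2)] by (auto simp: is_clique_def)
    qed
    moreover have "finite I"
      using is_coverD(1)[OF cov] sub is_coverD(2)[OF cov]
      by (auto simp: simple_graph_def intro: finite_subset)
    \<comment> \<open>The image of \<open>I\<close> under \<open>p\<close> lies in the finite set
      \<open>verts G\<close> and has the same cardinality, hence it is all of
      \<open>verts G\<close>.\<close>
    ultimately have pI: "p ` I = verts G"
      using p cI fin by (intro card_subset_eq) (auto simp: card_image)
    define f where "f = restrict (inv_into I p) (verts G)"
    have fI: "f v \<in> I" "p (f v) = v" if "v \<in> verts G" for v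
      using that pI by (auto simp: f_def inv_into_into f_inv_into_f)
    have "f ` verts G = I"
    proof
      show "f ` verts G \<subseteq> I" using fI by auto
      show "I \<subseteq> f ` verts G"
      proof
        fix x assume "x \<in> I"
        then have "f (p x) = x" using p \<open>inj_on p I\<close> by (simp add: f_def)
        then show "x \<in> f ` verts G" using p[OF \<open>x \<in> I\<close>] by force
      qed
    qed
    moreover have "f \<in> cover_transversals G L H"
    proof -
      have "f v \<in> L v" if "v \<in> verts G" for v
        using p[OF fI(1)[OF that]] fI(2)[OF that] by simp
      then have "f \<in> PiE (verts G) L" by (auto simp: f_def)
      then show ?thesis using ind fI by (auto simp: cover_transversals_def)
    qed
    ultimately show ?thesis by blast
  qed
  ultimately show ?thesis using inj by (auto simp: bij_betw_def)
qed

text \<open>Each neighbour of \<open>v\<close> in \<open>S\<close> excludes at most one label at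
  \<open>v\<close>, because the edges between two lists form a matching.\<close>

lemma extend_partial_coloring:
  assumes cov: "is_cover G L H" and "simple_graph G"
    and v: "v \<in> verts G" and S: "S \<subseteq> verts G"
    and f: "\<And>u. u \<in> S \<Longrightarrow> f u \<in> L u"
    and deg: "card {u \<in> S. {u, v} \<in> edges G} < card (L v)"
  shows "\<exists>x\<in>L v. \<forall>u\<in>S. u \<noteq> v \<longrightarrow> {f u, x} \<notin> edges H"
proof -
  define N where "N = {u \<in> S. {u, v} \<in> edges G}"
  have finN: "finite N"
    using S \<open>simple_graph G\<close> by (auto simp: N_def simple_graph_def intro: finite_subset)
  \<comment> \<open>If a neighbour excludes no label, \<open>SOME\<close> yields an arbitrary value.
    This is harmless: \<open>B\<close> must only contain all excluded labels and have at most
    \<open>card N\<close> elements.\<close>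
  define B where "B = (\<lambda>u. SOME x. x \<in> L v \<and> {f u, x} \<in> edges H) ` N"
  have "card B \<le> card N" unfolding B_def by (rule card_image_le[OF finN])
  then have "card B < card (L v)" using deg by (simp add: N_def)
  moreover have "finite B" using finN by (simp add: B_def)
  ultimately have "\<not> L v \<subseteq> B" using card_mono[of B "L v"] by linarith
  then obtain x where x: "x \<in> L v" "x \<notin> B" by blast
  have "{f u, x} \<notin> edges H" if "u \<in> S" "u \<noteq> v" for u
  proof
    assume e: "{f u, x} \<in> edges H"
    have uv: "{u, v} \<in> edges G" using is_coverD(6)[OF cov _ v that(2) f[OF that(1)] x(1) e] S that by auto
    define y where "y = (SOME x. x \<in> L v \<and> {f u, x} \<in> edges H)"
    have "y \<in> L v \<and> {f u, y} \<in> edges H" unfolding y_def by (rule someI) (use x e in auto)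
    then have "y = x"
      using cover_matching_unique[OF cov _ v uv f[OF that(1)] _ x(1) _ e] S that by auto
    moreover have "y \<in> B" using that uv by (auto simp: B_def y_def N_def)
    ultimately show False using x by simp
  qed
  then show ?thesis using x by blast
qed

text \<open>Greedy coloring by induction on \<open>S\<close>: a vertex with fewer than
  \<open>d\<close> neighbours in \<open>S\<close> is colored after the rest of
  \<open>S\<close>.\<close>

lemma degenerate_cover_coloring:
  assumes G: "simple_graph G"
    and degen: "\<And>S. \<lbrakk>S \<subseteq> verts G; S \<noteq> {}\<rbrakk> \<Longrightarrow> \<exists>v\<in>S. card {u \<in> S. {u, v} \<in> edges G} < d"
    and cov: "is_fold_cover d G L H"
  shows "cover_colorings G H \<noteq> {}"
proof -
  have c: "is_cover G L H" and d: "\<And>v. v \<in> verts G \<Longrightarrow> card (L v) = d"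
    using cov by (auto simp: is_fold_cover_def)
  have fin: "finite (verts G)" using G by (simp add: simple_graph_def)
  have "\<forall>e\<in>edges H. card e = 2"
    using is_coverD(1)[OF c] by (simp add: simple_graph_def)
  then have nl: "{x} \<notin> edges H" for x by force
  have "\<exists>f. (\<forall>u\<in>S. f u \<in> L u) \<and> (\<forall>u\<in>S. \<forall>w\<in>S. {f u, f w} \<notin> edges H)"
    if "finite S" "S \<subseteq> verts G" for S
    using that
  proof (induction S rule: finite_psubset_induct)
    case (psubset S)
    show ?case
    proof (cases "S = {}")
      case False
      then obtain v where v: "v \<in> S" "card {u \<in> S. {u, v} \<in> edges G} < d"
        using degen psubset.prems by blast
      obtain f where f: "\<forall>u\<in>S-{v}. f u \<in> L u"
          "\<forall>u\<in>S-{v}. \<forall>w\<in>S-{v}. {f u, f w} \<notin> edges H"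
        using psubset.IH[of "S - {v}"] v(1) psubset.prems by blast
      have "card {u \<in> S - {v}. {u, v} \<in> edges G} \<le> card {u \<in> S. {u, v} \<in> edges G}"
        using psubset.hyps by (intro card_mono) auto
      then obtain x where x: "x \<in> L v" "\<forall>u\<in>S-{v}. u \<noteq> v \<longrightarrow> {f u, x} \<notin> edges H"
        using extend_partial_coloring[OF c G, of v "S - {v}" f] v d psubset.prems f(1) by force
      have sym: "{x, f u} \<notin> edges H" if "u \<in> S" "u \<noteq> v" for u
        using x that by (metis Diff_iff insert_commute singletonD)
      show ?thesis
      proof (intro exI conjI ballI)
        fix u assume "u \<in> S" then show "(f(v := x)) u \<in> L u" using f x by auto
      next
        fix u w assume "u \<in> S" "w \<in> S"
        then show "{(f(v := x)) u, (f(v := x)) w} \<notin> edges H"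
          using f(2) x sym nl by auto
      qed
    qed simp
  qed
  from this[OF fin subset_refl] obtain f where
    "\<forall>u\<in>verts G. f u \<in> L u" "\<forall>u\<in>verts G. \<forall>w\<in>verts G. {f u, f w} \<notin> edges H" by blast
  then have "restrict f (verts G) \<in> cover_transversals G L H"
    by (auto simp: cover_transversals_def)
  then show ?thesis
    using cover_colorings_transversals[OF c fin] by (auto simp: bij_betw_def)
qed

section \<open>Covers given by one map on each arc of an orientation\<close>

text \<open>All lists are copies of one label set. Using arcs attaches a single map to an edge,
  without a compatibility condition between the two directions. A label whose image lies outside
  \<open>C\<close> stays unmatched along that arc.\<close>

definition labelled_cover :: "'a ugraph \<Rightarrow> 'c set \<Rightarrow> ('a \<Rightarrow> 'a \<Rightarrow> bool) \<Rightarrow> ('a \<Rightarrow> 'a \<Rightarrow> 'c \<Rightarrow> 'c)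
    \<Rightarrow> ('a \<times> 'c) ugraph" where
  "labelled_cover G C D g = \<lparr>verts = verts G \<times> C,
     edges = {{(u, x), (v, y)} | u x v y. u \<in> verts G \<and> v \<in> verts G \<and> x \<in> C \<and> y \<in> C \<and>
                (u = v \<and> x \<noteq> y \<or> D u v \<and> y = g u v x)}\<rparr>"

definition labelled_colorings :: "'a ugraph \<Rightarrow> 'c set \<Rightarrow> ('a \<Rightarrow> 'a \<Rightarrow> bool) \<Rightarrow> ('a \<Rightarrow> 'a \<Rightarrow> 'c \<Rightarrow> 'c)
    \<Rightarrow> ('a \<Rightarrow> 'c) set" where
  "labelled_colorings G C D g =
     {f \<in> verts G \<rightarrow>\<^sub>E C. \<forall>u\<in>verts G. \<forall>v\<in>verts G. D u v \<longrightarrow> f v \<noteq> g u v (f u)}"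

locale orientation =
  fixes G :: "'a ugraph" and D :: "'a \<Rightarrow> 'a \<Rightarrow> bool"
  assumes simple: "simple_graph G"
    and arc_edge: "\<lbrakk>u \<in> verts G; v \<in> verts G; D u v\<rbrakk> \<Longrightarrow> {u, v} \<in> edges G"
    and asym: "\<lbrakk>u \<in> verts G; v \<in> verts G; D u v\<rbrakk> \<Longrightarrow> \<not> D v u"
begin

lemma labelled_cover_edge:
  assumes "u \<in> verts G" "v \<in> verts G" "x \<in> C" "y \<in> C"
  shows "{(u, x), (v, y)} \<in> edges (labelled_cover G C D g) \<longleftrightarrow>
     u = v \<and> x \<noteq> y \<or> D u v \<and> y = g u v x \<or> D v u \<and> x = g v u y"
  (is "?e \<in> _ \<longleftrightarrow> ?R")
proof
  assume "?e \<in> edges (labelled_cover G C D g)"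
  then obtain u' x' v' y' where "?e = {(u', x'), (v', y')}"
      "u' = v' \<and> x' \<noteq> y' \<or> D u' v' \<and> y' = g u' v' x'"
    unfolding labelled_cover_def by auto
  then show ?R unfolding doubleton_eq_iff prod.inject by metis
next
  assume ?R
  then consider "u = v \<and> x \<noteq> y \<or> D u v \<and> y = g u v x" | "D v u \<and> x = g v u y" by blast
  then show "?e \<in> edges (labelled_cover G C D g)"
  proof cases
    case 1
    then show ?thesis
      unfolding labelled_cover_def using assms by simp blast
  next
    case 2
    moreover have "?e = {(v, y), (u, x)}" by (rule insert_commute)
    ultimately show ?thesis
      unfolding labelled_cover_def using assms by simp blast
  qed
qed

text \<open>Injectivity of each map on \<open>C\<close> makes the cross edges a matching. Images may
  leave \<open>C\<close>, which permits shrinking the label set later.\<close>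

lemma labelled_cover_is_cover:
  assumes C: "finite C" "C \<noteq> {}"
    and inj: "\<And>u v. \<lbrakk>u \<in> verts G; v \<in> verts G; D u v\<rbrakk> \<Longrightarrow> inj_on (g u v) C"
  shows "is_fold_cover (card C) G (\<lambda>v. {v} \<times> C) (labelled_cover G C D g)"
proof -
  let ?H = "labelled_cover G C D g" and ?L = "\<lambda>v. {v} \<times> C"
  have fin: "finite (verts G)" using simple by (simp add: simple_graph_def)
  have ne: "u \<noteq> v" if "u \<in> verts G" "v \<in> verts G" "D u v" for u v
    using asym that by blast
  have "simple_graph ?H"
    unfolding simple_graph_def
  proof (intro conjI ballI)
    show "finite (verts ?H)" using fin C by (simp add: labelled_cover_def)
    fix e assume "e \<in> edges ?H"
    then obtain u x v y where e: "e = {(u, x), (v, y)}" "u \<in> verts G" "v \<in> verts G" "x \<in> C" "y \<in> C"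
      "u = v \<and> x \<noteq> y \<or> D u v \<and> y = g u v x"
      unfolding labelled_cover_def by auto
    show "e \<subseteq> verts ?H" using e by (auto simp: labelled_cover_def)
    have "(u, x) \<noteq> (v, y)" using e ne by auto
    then show "card e = 2" using e(1) by simp
  qed
  moreover have "partition_on (verts ?H) (?L ` verts G)"
    using C by (auto simp: partition_on_def labelled_cover_def disjoint_def)
  moreover have "card (?L ` verts G) = card (verts G)"
    using C by (intro card_image inj_onI) auto
  moreover have "is_clique ?H (?L v)" if "v \<in> verts G" for v
    using that labelled_cover_edge by (fastforce simp: is_clique_def)
  moreover have "{u, v} \<in> edges G"
    if "u \<in> verts G" "v \<in> verts G" "u \<noteq> v" and ne: "edges_between ?H (?L u) (?L v) \<noteq> {}" for u v
  proof -
    obtain x y where "x \<in> C" "y \<in> C" "{(u, x), (v, y)} \<in> edges ?H"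
      using ne by (auto simp: edges_between_def)
    then have "D u v \<or> D v u" using labelled_cover_edge[of u v x C y g] that by auto
    then show ?thesis using arc_edge that by (metis insert_commute)
  qed
  moreover have "disjoint (edges_between ?H (?L u) (?L v))"
    if uv: "u \<in> verts G" "v \<in> verts G" "{u, v} \<in> edges G" for u v
  proof -
    have "u \<noteq> v" using simple uv by (force simp: simple_graph_def)
    \<comment> \<open>By \<open>asym\<close> only one of the two arcs is present, so both edges come
      from the same map, and its functionality or injectivity identifies them.\<close>
    have key: "x = x' \<and> y = y'"
      if "x \<in> C" "y \<in> C" "x' \<in> C" "y' \<in> C" "{(u, x), (v, y)} \<in> edges ?H"
        "{(u, x'), (v, y')} \<in> edges ?H" "x = x' \<or> y = y'" for x y x' y'
    proof -
      have "D u v \<and> y = g u v x \<or> D v u \<and> x = g v u y"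
           "D u v \<and> y' = g u v x' \<or> D v u \<and> x' = g v u y'"
        using that(5,6) labelled_cover_edge[OF uv(1,2) that(1,2)]
          labelled_cover_edge[OF uv(1,2) that(3,4)] \<open>u \<noteq> v\<close> by auto
      then consider "D u v" "y = g u v x" "y' = g u v x'" | "D v u" "x = g v u y" "x' = g v u y'"
        using asym[OF uv(1,2)] by blast
      then show ?thesis
      proof cases
        case 1
        then show ?thesis using inj_onD[OF inj[OF uv(1,2) 1(1)], of x x'] that by auto
      next
        case 2
        then show ?thesis using inj_onD[OF inj[OF uv(2,1) 2(1)], of y y'] that by auto
      qed
    qed
    show ?thesis
      unfolding disjoint_def
    proof (intro ballI impI)
      fix a b assume "a \<in> edges_between ?H (?L u) (?L v)" "b \<in> edges_between ?H (?L u) (?L v)"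
        and ab: "a \<noteq> b"
      then obtain x y x' y' where e: "a = {(u, x), (v, y)}" "b = {(u, x'), (v, y')}"
        "x \<in> C" "y \<in> C" "x' \<in> C" "y' \<in> C" "a \<in> edges ?H" "b \<in> edges ?H"
        unfolding edges_between_def by blast
      then have "x \<noteq> x' \<and> y \<noteq> y'" using key[of x y x' y'] ab by blast
      then show "a \<inter> b = {}" unfolding e(1,2) using \<open>u \<noteq> v\<close> by simp
    qed
  qed
  ultimately have "is_cover G ?L ?H" unfolding is_cover_def by (intro conjI ballI impI)
  then show ?thesis by (simp add: is_fold_cover_def card_cartesian_product)
qed

lemma labelled_cover_colorings:
  assumes C: "finite C" "C \<noteq> {}"
    and inj: "\<And>u v. \<lbrakk>u \<in> verts G; v \<in> verts G; D u v\<rbrakk> \<Longrightarrow> inj_on (g u v) C"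
  shows "card (cover_colorings G (labelled_cover G C D g)) = card (labelled_colorings G C D g)"
    and "cover_colorings G (labelled_cover G C D g) = {} \<longleftrightarrow> labelled_colorings G C D g = {}"
proof -
  let ?H = "labelled_cover G C D g" and ?L = "\<lambda>v. {v} \<times> C"
  have fin: "finite (verts G)" using simple by (simp add: simple_graph_def)
  have cov: "is_cover G ?L ?H"
    using labelled_cover_is_cover[OF assms] by (simp add: is_fold_cover_def)
  let ?\<phi> = "\<lambda>f. restrict (\<lambda>v. (v, f v)) (verts G)"
  have mem: "?\<phi> f \<in> cover_transversals G ?L ?H \<longleftrightarrow> f \<in> labelled_colorings G C D g"
    if "f \<in> verts G \<rightarrow>\<^sub>E C" for f
  proof -
    have e: "{?\<phi> f u, ?\<phi> f v} \<in> edges ?H \<longleftrightarrow> D u v \<and> f v = g u v (f u) \<or> D v u \<and> f u = g v u (f v)"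
      if "u \<in> verts G" "v \<in> verts G" for u v
      using labelled_cover_edge[of u v "f u" C "f v" g] that \<open>f \<in> verts G \<rightarrow>\<^sub>E C\<close> by auto
    have "?\<phi> f \<in> PiE (verts G) ?L" using that by auto
    then show ?thesis
      using that e unfolding cover_transversals_def labelled_colorings_def by blast
  qed
  have "bij_betw ?\<phi> (labelled_colorings G C D g) (cover_transversals G ?L ?H)"
  proof (rule bij_betw_imageI)
    show "inj_on ?\<phi> (labelled_colorings G C D g)"
    proof (rule inj_onI)
      fix f h assume f: "f \<in> labelled_colorings G C D g" and h: "h \<in> labelled_colorings G C D g"
        and eq: "?\<phi> f = ?\<phi> h"
      have "f v = h v" if "v \<in> verts G" for v using fun_cong[OF eq, of v] that by simp
      then show "f = h"
        using f h by (intro PiE_ext[of f "verts G" "\<lambda>_. C" h]) (auto simp: labelled_colorings_def)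
    qed
    show "?\<phi> ` labelled_colorings G C D g = cover_transversals G ?L ?H"
    proof (intro set_eqI iffI)
      fix F assume "F \<in> ?\<phi> ` labelled_colorings G C D g"
      then show "F \<in> cover_transversals G ?L ?H"
        using mem by (auto simp: labelled_colorings_def)
    next
      fix F assume F: "F \<in> cover_transversals G ?L ?H"
      define f where "f = restrict (snd \<circ> F) (verts G)"
      have FP: "F \<in> PiE (verts G) ?L" using F by (simp add: cover_transversals_def)
      have val: "F v = (v, f v) \<and> f v \<in> C" if "v \<in> verts G" for v
        using PiE_mem[OF FP that] that by (auto simp: f_def)
      have "?\<phi> f = F"
        using FP val by (intro PiE_ext[of _ "verts G" ?L]) auto
      moreover have "f \<in> verts G \<rightarrow>\<^sub>E C" using val by (auto simp: f_def)
      ultimately have "f \<in> labelled_colorings G C D g" using mem[of f] F by blast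
      then show "F \<in> ?\<phi> ` labelled_colorings G C D g" using \<open>?\<phi> f = F\<close> by blast
    qed
  qed
  note bij = bij_betw_trans[OF this cover_colorings_transversals[OF cov fin]]
  show "card (cover_colorings G ?H) = card (labelled_colorings G C D g)"
    using bij_betw_same_card[OF bij] by simp
  show "cover_colorings G ?H = {} \<longleftrightarrow> labelled_colorings G C D g = {}"
    using bij_betw_imp_surj_on[OF bij] by blast
qed

end

section \<open>Colorings of covers of even cycles\<close>

definition walks :: "'c set \<Rightarrow> (nat \<Rightarrow> 'c \<Rightarrow> 'c) \<Rightarrow> 'c \<Rightarrow> nat \<Rightarrow> (nat \<Rightarrow> 'c) set" where
  "walks C \<sigma> a j = {f \<in> {..j} \<rightarrow>\<^sub>E C. f 0 = a \<and> (\<forall>i<j. f (Suc i) \<noteq> \<sigma> i (f i))}"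

text \<open>Follows the matching edges for \<open>j\<close> steps; this is the product of the
  permutations of the first \<open>j\<close> steps.\<close>

fun transport :: "(nat \<Rightarrow> 'c \<Rightarrow> 'c) \<Rightarrow> nat \<Rightarrow> 'c \<Rightarrow> 'c" where
  "transport \<sigma> 0 = id"
| "transport \<sigma> (Suc j) = \<sigma> j \<circ> transport \<sigma> j"

definition cycle_colorings_from :: "'c set \<Rightarrow> (nat \<Rightarrow> 'c \<Rightarrow> 'c) \<Rightarrow> nat \<Rightarrow> 'c \<Rightarrow> (nat \<Rightarrow> 'c) set" where
  "cycle_colorings_from C \<sigma> n a =
     {f \<in> {..<n} \<rightarrow>\<^sub>E C. f 0 = a \<and> (\<forall>u<n. f (Suc u mod n) \<noteq> \<sigma> u (f u))}"

definition cycle_colorings :: "'c set \<Rightarrow> (nat \<Rightarrow> 'c \<Rightarrow> 'c) \<Rightarrow> nat \<Rightarrow> (nat \<Rightarrow> 'c) set" where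
  "cycle_colorings C \<sigma> n = {f \<in> {..<n} \<rightarrow>\<^sub>E C. \<forall>u<n. f (Suc u mod n) \<noteq> \<sigma> u (f u)}"

lemma finite_walks: "finite C \<Longrightarrow> finite (walks C \<sigma> a j)"
  unfolding walks_def by (rule finite_subset[of _ "{..j} \<rightarrow>\<^sub>E C"]) (auto intro: finite_PiE)

text \<open>Restriction to \<open>{..j}\<close> loses only the prescribed label \<open>b\<close>.
  With \<open>b = a\<close> the same bijection relates walks that return to \<open>a\<close> to
  colorings of a cycle.\<close>

lemma walks_Suc_end:
  assumes "b \<in> C"
  shows "card {f \<in> walks C \<sigma> a (Suc j). f (Suc j) = b} = card {f \<in> walks C \<sigma> a j. \<sigma> j (f j) \<noteq> b}"
proof (rule bij_betw_same_card[of "\<lambda>f. restrict f {..j}"], rule bij_betw_byWitness[where f' = "\<lambda>f. f(Suc j := b)"])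
  show "\<forall>f\<in>{f \<in> walks C \<sigma> a (Suc j). f (Suc j) = b}. (restrict f {..j})(Suc j := b) = f"
  proof
    fix f assume f: "f \<in> {f \<in> walks C \<sigma> a (Suc j). f (Suc j) = b}"
    show "(restrict f {..j})(Suc j := b) = f"
    proof
      fix i show "((restrict f {..j})(Suc j := b)) i = f i"
      proof (cases "i \<le> Suc j")
        case False
        then show ?thesis using f PiE_arb[of f "{..Suc j}" "\<lambda>_. C" i] by (auto simp: walks_def)
      qed (use f in auto)
    qed
  qed
  show "\<forall>f\<in>{f \<in> walks C \<sigma> a j. \<sigma> j (f j) \<noteq> b}. restrict (f(Suc j := b)) {..j} = f"
  proof
    fix f assume "f \<in> {f \<in> walks C \<sigma> a j. \<sigma> j (f j) \<noteq> b}"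
    then have f: "f \<in> {..j} \<rightarrow>\<^sub>E C" by (simp add: walks_def)
    show "restrict (f(Suc j := b)) {..j} = f"
    proof
      fix i show "restrict (f(Suc j := b)) {..j} i = f i"
        using PiE_arb[OF f, of i] by auto
    qed
  qed
  show "(\<lambda>f. restrict f {..j}) ` {f \<in> walks C \<sigma> a (Suc j). f (Suc j) = b}
          \<subseteq> {f \<in> walks C \<sigma> a j. \<sigma> j (f j) \<noteq> b}"
  proof (rule image_subsetI)
    fix f assume f: "f \<in> {f \<in> walks C \<sigma> a (Suc j). f (Suc j) = b}"
    then have "f i \<in> C" if "i \<le> j" for i using that by (auto simp: walks_def)
    then show "restrict f {..j} \<in> {f \<in> walks C \<sigma> a j. \<sigma> j (f j) \<noteq> b}"
      using f by (auto simp: walks_def)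
  qed
  show "(\<lambda>f. f(Suc j := b)) ` {f \<in> walks C \<sigma> a j. \<sigma> j (f j) \<noteq> b}
          \<subseteq> {f \<in> walks C \<sigma> a (Suc j). f (Suc j) = b}"
  proof (rule image_subsetI)
    fix f assume f: "f \<in> {f \<in> walks C \<sigma> a j. \<sigma> j (f j) \<noteq> b}"
    then have fP: "f \<in> {..j} \<rightarrow>\<^sub>E C" by (simp add: walks_def)
    have "f(Suc j := b) \<in> {..Suc j} \<rightarrow>\<^sub>E C"
    proof (rule PiE_I)
      fix i assume "i \<in> {..Suc j}"
      then show "(f(Suc j := b)) i \<in> C" using assms PiE_mem[OF fP, of i] by auto
    next
      fix i assume "i \<notin> {..Suc j}"
      then show "(f(Suc j := b)) i = undefined" using PiE_arb[OF fP, of i] by auto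
    qed
    moreover have "(f(Suc j := b)) (Suc i) \<noteq> \<sigma> i ((f(Suc j := b)) i)" if "i < Suc j" for i
      using that f by (cases "i = j") (auto simp: walks_def)
    ultimately show "f(Suc j := b) \<in> {f \<in> walks C \<sigma> a (Suc j). f (Suc j) = b}"
      using f by (auto simp: walks_def)
  qed
qed

lemma transport_closed:
  assumes "\<And>i. i < j \<Longrightarrow> bij_betw (\<sigma> i) C C" "a \<in> C"
  shows "transport \<sigma> j a \<in> C"
  using assms by (induction j) (auto dest: bij_betwE)

text \<open>The adjacency matrix of one step is the all-ones matrix minus a permutation matrix, so its
  \<open>j\<close>-fold product is again a combination of these two, with the signs given here.\<close>

lemma card_walks:
  assumes C: "finite C" "card C = q" and a: "a \<in> C"
    and "\<And>i. i < j \<Longrightarrow> bij_betw (\<sigma> i) C C" and "b \<in> C"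
  shows "int q * int (card {f \<in> walks C \<sigma> a j. f j = b}) =
     (int q - 1) ^ j - (-1) ^ j + (-1) ^ j * int q * (if b = transport \<sigma> j a then 1 else 0)"
  using assms(4,5)
proof (induction j arbitrary: b)
  case 0
  have "{f \<in> walks C \<sigma> a 0. f 0 = b} = (if b = a then {\<lambda>i\<in>{..0}. a} else {})"
    using a by (auto simp: walks_def PiE_def extensional_def restrict_def fun_eq_iff)
  then show ?case by simp
next
  case (Suc j)
  have bij: "bij_betw (\<sigma> j) C C" using Suc.prems(1) by simp
  have walk_mem: "f j \<in> C" if "f \<in> walks C \<sigma> a j" for f
    using that by (auto simp: walks_def)
  obtain b' where b': "b' \<in> C" "\<sigma> j b' = b"
    using bij Suc.prems(2) by (metis bij_betw_imp_surj_on imageE)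
  have IH: "int q * int (card {f \<in> walks C \<sigma> a j. f j = b}) =
     (int q - 1) ^ j - (-1) ^ j + (-1) ^ j * int q * (if b = transport \<sigma> j a then 1 else 0)"
    if "b \<in> C" for b using Suc.IH[OF _ that] Suc.prems(1) by simp
  have tr: "transport \<sigma> j a \<in> C"
    using Suc.prems(1) a by (intro transport_closed) auto
  \<comment> \<open>Summation over the final label: the correction at the transported label cancels
    the alternating terms, which leaves \<open>(q - 1) ^ j\<close> walks.\<close>
  have "card (walks C \<sigma> a j) = (\<Sum>b\<in>C. card {f \<in> walks C \<sigma> a j. f j = b})"
  proof -
    have "walks C \<sigma> a j = (\<Union>b\<in>C. {f \<in> walks C \<sigma> a j. f j = b})" using walk_mem by auto
    also have "card \<dots> = (\<Sum>b\<in>C. card {f \<in> walks C \<sigma> a j. f j = b})"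
      using C(1) by (intro card_UN_disjoint) (auto simp: finite_walks)
    finally show ?thesis .
  qed
  then have "int q * int (card (walks C \<sigma> a j)) =
      (\<Sum>b\<in>C. int q * int (card {f \<in> walks C \<sigma> a j. f j = b}))"
    by (simp add: sum_distrib_left)
  also have "\<dots> = (\<Sum>b\<in>C. (int q - 1) ^ j - (-1) ^ j + (if b = transport \<sigma> j a then (-1) ^ j * int q else 0))"
    using IH by (intro sum.cong) auto
  also have "\<dots> = int q * (int q - 1) ^ j"
    using C tr by (simp add: sum.distrib right_diff_distrib)
  finally have total: "int q * int (card (walks C \<sigma> a j)) = int q * (int q - 1) ^ j" .
  \<comment> \<open>Since \<open>\<sigma> j\<close> is a permutation, exactly one label
    \<open>b'\<close> at position \<open>j\<close> prevents \<open>b\<close> at position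
    \<open>Suc j\<close>.\<close>
  have "{f \<in> walks C \<sigma> a j. \<sigma> j (f j) \<noteq> b} = walks C \<sigma> a j - {f \<in> walks C \<sigma> a j. f j = b'}"
    using b' bij walk_mem by (auto simp: bij_betw_def dest: inj_onD)
  then have "card {f \<in> walks C \<sigma> a (Suc j). f (Suc j) = b} =
      card (walks C \<sigma> a j) - card {f \<in> walks C \<sigma> a j. f j = b'}"
    using walks_Suc_end[OF Suc.prems(2)] C(1) by (simp add: card_Diff_subset finite_walks)
  moreover have "card {f \<in> walks C \<sigma> a j. f j = b'} \<le> card (walks C \<sigma> a j)"
    using C(1) by (intro card_mono) (auto simp: finite_walks)
  ultimately have step: "int q * int (card {f \<in> walks C \<sigma> a (Suc j). f (Suc j) = b}) =
      int q * int (card (walks C \<sigma> a j)) - int q * int (card {f \<in> walks C \<sigma> a j. f j = b'})"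
    by (simp add: of_nat_diff right_diff_distrib)
  have "b = transport \<sigma> (Suc j) a \<longleftrightarrow> b' = transport \<sigma> j a"
    using b' bij tr by (auto simp: bij_betw_def dest: inj_onD)
  then show ?case
    unfolding step total IH[OF b'(1)] by (simp add: algebra_simps)
qed

text \<open>The cycle is cut open at vertex \<open>0\<close>: its colorings correspond to walks of
  \<open>n\<close> steps from \<open>a\<close> back to \<open>a\<close>. Evenness of
  \<open>n\<close> removes the signs in \<open>card_walks\<close>.\<close>

lemma card_cycle_colorings_from:
  assumes C: "finite C" "card C = q" and a: "a \<in> C" and n: "even n" "0 < n"
    and bij: "\<And>i. i < n \<Longrightarrow> bij_betw (\<sigma> i) C C"
  shows "int q * int (card (cycle_colorings_from C \<sigma> n a)) =
     (int q - 1) ^ n - 1 + (if transport \<sigma> n a = a then int q else 0)"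
proof -
  obtain j where j: "n = Suc j" using n(2) gr0_conv_Suc by auto
  have "cycle_colorings_from C \<sigma> n a = {f \<in> walks C \<sigma> a j. \<sigma> j (f j) \<noteq> a}"
  proof -
    \<comment> \<open>The arc with \<open>u = j\<close> is the closing one, where
      \<open>Suc j mod n\<close> is \<open>0\<close>.\<close>
    have *: "(\<forall>u<n. f (Suc u mod n) \<noteq> \<sigma> u (f u)) \<longleftrightarrow>
        (\<forall>i<j. f (Suc i) \<noteq> \<sigma> i (f i)) \<and> \<sigma> j (f j) \<noteq> f 0" for f :: "nat \<Rightarrow> 'a"
    proof -
      have "(\<forall>u<j. f (Suc u mod Suc j) \<noteq> \<sigma> u (f u)) \<longleftrightarrow> (\<forall>i<j. f (Suc i) \<noteq> \<sigma> i (f i))"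
        by (intro all_cong) simp
      then show ?thesis by (auto simp: j less_Suc_eq all_conj_distrib)
    qed
    show ?thesis
      unfolding cycle_colorings_from_def walks_def *
      by (auto simp: j lessThan_Suc_atMost)
  qed
  then have "card (cycle_colorings_from C \<sigma> n a) = card {f \<in> walks C \<sigma> a n. f n = a}"
    using walks_Suc_end[OF a, of \<sigma> a j] j by simp
  then show ?thesis
    using card_walks[OF C a bij a] n(1) by auto
qed

lemma card_cycle_colorings:
  assumes "finite C" "0 < n"
  shows "card (cycle_colorings C \<sigma> n) = (\<Sum>a\<in>C. card (cycle_colorings_from C \<sigma> n a))"
proof -
  have "cycle_colorings C \<sigma> n = (\<Union>a\<in>C. cycle_colorings_from C \<sigma> n a)"
    using assms by (auto simp: cycle_colorings_def cycle_colorings_from_def)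
  also have "card \<dots> = (\<Sum>a\<in>C. card (cycle_colorings_from C \<sigma> n a))"
  proof (rule card_UN_disjoint)
    show "\<forall>a\<in>C. finite (cycle_colorings_from C \<sigma> n a)"
      using assms by (auto simp: cycle_colorings_from_def intro: finite_subset[of _ "{..<n} \<rightarrow>\<^sub>E C"] finite_PiE)
  qed (auto simp: cycle_colorings_from_def assms)
  finally show ?thesis .
qed

text \<open>A fixed point of the transport around the cycle only increases the count for its start
  label, so transport without fixed points is the extremal case.\<close>

lemma card_cycle_colorings_ge:
  assumes "finite C" "card C = q" "even n" "0 < n"
    and "\<And>i. i < n \<Longrightarrow> bij_betw (\<sigma> i) C C"
  shows "(int q - 1) ^ n - 1 \<le> int (card (cycle_colorings C \<sigma> n))"
proof (cases "q = 0")
  case False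
  have "(\<Sum>a\<in>C. (int q - 1) ^ n - 1) \<le> (\<Sum>a\<in>C. int q * int (card (cycle_colorings_from C \<sigma> n a)))"
    using card_cycle_colorings_from[OF assms(1,2) _ assms(3-5)] by (intro sum_mono) simp
  then have "int q * ((int q - 1) ^ n - 1) \<le> int q * int (card (cycle_colorings C \<sigma> n))"
    using assms by (simp add: card_cycle_colorings sum_distrib_left)
  then show ?thesis using False by simp
qed (use assms in simp)

text \<open>Concentrates the permutation on the closing arc from \<open>n - 1\<close> to
  \<open>0\<close>, so that the transport around the cycle is \<open>\<pi>\<close> itself.\<close>

definition twist_last :: "nat \<Rightarrow> ('c \<Rightarrow> 'c) \<Rightarrow> nat \<Rightarrow> 'c \<Rightarrow> 'c" where
  "twist_last n \<pi> u = (if Suc u = n then \<pi> else id)"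

lemma transport_twist_last: "0 < n \<Longrightarrow> transport (twist_last n \<pi>) n = \<pi>"
proof -
  assume "0 < n"
  have "transport (twist_last n \<pi>) j = id" if "j < n" for j
    using that by (induction j) (auto simp: twist_last_def)
  then show ?thesis using \<open>0 < n\<close> by (cases n) (auto simp: twist_last_def)
qed

lemma bij_betw_twist_last: "bij_betw \<pi> C C \<Longrightarrow> bij_betw (twist_last n \<pi> u) C C"
  by (simp add: twist_last_def)

lemma bij_betw_add_mod:
  assumes "0 < q"
  shows "bij_betw (\<lambda>x. (x + d) mod q) {0..<q} {0..<(q::int)}"
proof (rule bij_betw_byWitness[where f' = "\<lambda>x. (x - d) mod q"])
  show "\<forall>x\<in>{0..<q}. ((x + d) mod q - d) mod q = x" by (simp add: mod_diff_left_eq)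
  show "\<forall>x\<in>{0..<q}. ((x - d) mod q + d) mod q = x" by (simp add: mod_add_left_eq)
qed (use assms in auto)

text \<open>For \<open>q \<ge> 2\<close> the shift by one has no fixed point, so every start label
  contributes the least possible number of colorings.\<close>

lemma card_twisted_cycle_colorings:
  assumes n: "even n" "0 < n" and q: "2 \<le> q"
  defines "\<sigma> \<equiv> twist_last n (\<lambda>x. (x + 1) mod int q)"
  shows "a \<in> {0..<int q} \<Longrightarrow>
           int q * int (card (cycle_colorings_from {0..<int q} \<sigma> n a)) = (int q - 1) ^ n - 1"
    and "int (card (cycle_colorings {0..<int q} \<sigma> n)) = (int q - 1) ^ n - 1"
proof -
  have bij: "bij_betw (\<sigma> i) {0..<int q} {0..<int q}" for i
    unfolding \<sigma>_def using q by (intro bij_betw_twist_last bij_betw_add_mod) simp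
  have nofix: "(a + 1) mod int q \<noteq> a" if "a \<in> {0..<int q}" for a
    using that q by (cases "a + 1 = int q") auto
  show start: "int q * int (card (cycle_colorings_from {0..<int q} \<sigma> n a)) = (int q - 1) ^ n - 1"
    if "a \<in> {0..<int q}" for a
    using card_cycle_colorings_from[of "{0..<int q}" q a n \<sigma>] that n bij nofix
      transport_twist_last[OF n(2), of "\<lambda>x. (x + 1) mod int q"] by (simp add: \<sigma>_def)
  have "int q * int (card (cycle_colorings {0..<int q} \<sigma> n)) =
      (\<Sum>a\<in>{0..<int q}. int q * int (card (cycle_colorings_from {0..<int q} \<sigma> n a)))"
    using n by (simp add: card_cycle_colorings sum_distrib_left)
  also have "\<dots> = int q * ((int q - 1) ^ n - 1)"
    using start by simp
  finally show "int (card (cycle_colorings {0..<int q} \<sigma> n)) = (int q - 1) ^ n - 1"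
    using q by simp
qed

section \<open>Arbitrary covers of cycles, and the value of \<open>P_DP\<close> for even
  cycles\<close>

text \<open>\<open>R\<close> is a partial injection; the complements of its domain and of its image
  in the finite set \<open>C\<close> have equal size and can be matched arbitrarily.\<close>

lemma matching_extends_to_bijection:
  assumes C: "finite C"
    and func: "\<And>x y y'. \<lbrakk>x \<in> C; y \<in> C; y' \<in> C; R x y; R x y'\<rbrakk> \<Longrightarrow> y = y'"
    and inj: "\<And>x x' y. \<lbrakk>x \<in> C; x' \<in> C; y \<in> C; R x y; R x' y\<rbrakk> \<Longrightarrow> x = x'"
  shows "\<exists>\<sigma>. bij_betw \<sigma> C C \<and> (\<forall>x\<in>C. \<forall>y\<in>C. R x y \<longrightarrow> y = \<sigma> x)"
proof -
  define A where "A = {x \<in> C. \<exists>y\<in>C. R x y}"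
  define g where "g = (\<lambda>x. SOME y. y \<in> C \<and> R x y)"
  have g: "g x \<in> C \<and> R x (g x)" if "x \<in> A" for x
    unfolding g_def by (rule someI_ex) (use that in \<open>auto simp: A_def\<close>)
  have AC: "A \<subseteq> C" and gA: "g ` A \<subseteq> C" using g by (auto simp: A_def)
  have "inj_on g A"
  proof (rule inj_onI)
    fix x x' assume x: "x \<in> A" "x' \<in> A" "g x = g x'"
    then show "x = x'" using inj[of x x' "g x"] g[of x] g[of x'] AC by auto
  qed
  then have bij_g: "bij_betw g A (g ` A)" by (rule inj_on_imp_bij_betw)
  have "card (C - A) = card (C - g ` A)"
    using C AC gA \<open>inj_on g A\<close> by (simp add: card_Diff_subset finite_subset card_image)
  then obtain h where "bij_betw h (C - A) (C - g ` A)"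
    using C by (metis finite_Diff finite_same_card_bij)
  then have "bij_betw (\<lambda>x. if x \<in> A then g x else h x) (A \<union> (C - A)) (g ` A \<union> (C - g ` A))"
    by (intro bij_betw_disjoint_Un bij_g) auto
  then have "bij_betw (\<lambda>x. if x \<in> A then g x else h x) C C"
    using AC gA by (simp add: Un_absorb1)
  moreover have "y = (if x \<in> A then g x else h x)" if "x \<in> C" "y \<in> C" "R x y" for x y
    using that g[of x] func[of x y "g x"] by (auto simp: A_def)
  ultimately show ?thesis by blast
qed

lemma cycle_edge_iff:
  assumes "u < n" "v < n"
  shows "{u, v} \<in> edges (cycle_graph n) \<longleftrightarrow> v = Suc u mod n \<or> u = Suc v mod n"
  using assms by (auto simp: cycle_graph_def doubleton_eq_iff)

lemma verts_cycle [simp]: "verts (cycle_graph n) = {..<n}"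
  by (simp add: cycle_graph_def)

lemma Suc_mod_neq: "2 \<le> n \<Longrightarrow> u < n \<Longrightarrow> Suc u mod n \<noteq> u"
  by (cases "Suc u = n") auto

lemma Suc_Suc_mod_neq: "3 \<le> n \<Longrightarrow> u < n \<Longrightarrow> Suc (Suc u mod n) mod n \<noteq> u"
  by (cases "Suc u = n"; cases "Suc (Suc u) = n") auto

lemma Suc_mod_inj: "u < n \<Longrightarrow> v < n \<Longrightarrow> Suc u mod n = Suc v mod n \<Longrightarrow> u = v"
  by (cases "Suc u = n"; cases "Suc v = n") auto

lemma simple_graph_cycle: "2 \<le> n \<Longrightarrow> simple_graph (cycle_graph n)"
proof -
  assume n: "2 \<le> n"
  have "card {u, Suc u mod n} = 2" if "u < n" for u
    using Suc_mod_neq[OF n that] by (intro card_2_iff[THEN iffD2]) blast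
  then show ?thesis using n by (auto simp: simple_graph_def cycle_graph_def)
qed

lemma card_cycle_neighbours:
  assumes "v < n"
  shows "card {u. u < n \<and> {u, v} \<in> edges (cycle_graph n)} \<le> 2"
proof -
  let ?B = "{u. u < n \<and> Suc u mod n = v}"
  have "card ?B \<le> 1"
    by (rule card_le_Suc0_iff_eq[THEN iffD2, unfolded One_nat_def[symmetric]])
       (auto intro: Suc_mod_inj)
  moreover have "card (insert (Suc v mod n) ?B) \<le> Suc (card ?B)"
    by (rule card_insert_le_m1) simp_all
  moreover have "card {u. u < n \<and> {u, v} \<in> edges (cycle_graph n)} \<le> card (insert (Suc v mod n) ?B)"
    using assms by (intro card_mono) (auto simp: cycle_edge_iff)
  ultimately show ?thesis by linarith
qed

text \<open>For \<open>n = 2\<close> the arcs between \<open>0\<close> and \<open>1\<close> would be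
  opposite to each other, which \<open>asym\<close> excludes; hence the bound
  \<open>3\<close>.\<close>

lemma orientation_cycle:
  assumes "3 \<le> n"
  shows "orientation (cycle_graph n) (\<lambda>u v. v = Suc u mod n)"
proof
  show "simple_graph (cycle_graph n)" using assms by (intro simple_graph_cycle) simp
next
  fix u v assume "u \<in> verts (cycle_graph n)" "v \<in> verts (cycle_graph n)" "v = Suc u mod n"
  then show "{u, v} \<in> edges (cycle_graph n)" "u \<noteq> Suc v mod n"
    using Suc_Suc_mod_neq[OF assms, of u] by (auto simp: cycle_edge_iff)
qed

lemma labelled_colorings_cycle:
  assumes "0 < n"
  shows "labelled_colorings (cycle_graph n) C (\<lambda>u v. v = Suc u mod n) (\<lambda>u v. \<sigma> u) = cycle_colorings C \<sigma> n"
  using assms by (auto simp: labelled_colorings_def cycle_colorings_def)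

text \<open>Every list is identified with \<open>{..<q}\<close> and every matching is completed to a
  permutation. Completion only adds constraints, so the count for permutations is a lower
  bound.\<close>

lemma card_cycle_cover_colorings_ge:
  assumes cov: "is_fold_cover q (cycle_graph n) L H" and n: "even n" "3 \<le> n"
  shows "(int q - 1) ^ n - 1 \<le> int (card (cover_colorings (cycle_graph n) H))"
proof -
  let ?G = "cycle_graph n"
  have c: "is_cover ?G L H" and cardL: "\<And>v. v < n \<Longrightarrow> card (L v) = q"
    using cov by (auto simp: is_fold_cover_def)
  have fin: "finite (verts ?G)" by simp
  have simpleH: "finite (verts H)" "\<And>e. e \<in> edges H \<Longrightarrow> card e = 2"
    using is_coverD(1)[OF c] by (auto simp: simple_graph_def)
  have finL: "finite (L v)" if "v < n" for v
    using simpleH(1) is_coverD(2)[OF c] that by (auto intro: finite_subset)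
  have "\<exists>\<beta>. bij_betw \<beta> {..<q} (L v)" if "v < n" for v
    using finL[OF that] cardL[OF that] by (intro finite_same_card_bij) auto
  then obtain \<beta> where \<beta>: "\<And>v. v < n \<Longrightarrow> bij_betw (\<beta> v) {..<q} (L v)" by metis
  have \<beta>L: "\<beta> v x \<in> L v" if "v < n" "x < q" for v x
    using \<beta>[OF that(1)] that(2) by (auto dest: bij_betwE)
  have \<beta>inj: "x = y" if "v < n" "x < q" "y < q" "\<beta> v x = \<beta> v y" for v x y
    using \<beta>[OF that(1)] that(2-4) by (auto simp: bij_betw_def dest: inj_onD)
  have "\<exists>\<sigma>. bij_betw \<sigma> {..<q} {..<q} \<and>
      (\<forall>x\<in>{..<q}. \<forall>y\<in>{..<q}. {\<beta> u x, \<beta> (Suc u mod n) y} \<in> edges H \<longrightarrow> y = \<sigma> x)" if u: "u < n" for u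
  proof (rule matching_extends_to_bijection)
    let ?v = "Suc u mod n"
    have v: "?v < n" using n by simp
    have e: "{u, ?v} \<in> edges ?G" using u v by (simp add: cycle_edge_iff)
    fix x y y' assume "x \<in> {..<q}" "y \<in> {..<q}" "y' \<in> {..<q}"
      "{\<beta> u x, \<beta> ?v y} \<in> edges H" "{\<beta> u x, \<beta> ?v y'} \<in> edges H"
    then show "y = y'"
      using cover_matching_unique[OF c _ _ e \<beta>L[OF u] \<beta>L[OF v] \<beta>L[OF v], of x y y'] u v
      by (intro \<beta>inj[OF v]) auto
  next
    let ?v = "Suc u mod n"
    have v: "?v < n" using n by simp
    have e: "{?v, u} \<in> edges ?G" using u v by (simp add: cycle_edge_iff)
    fix x x' y assume "x \<in> {..<q}" "x' \<in> {..<q}" "y \<in> {..<q}"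
      "{\<beta> u x, \<beta> ?v y} \<in> edges H" "{\<beta> u x', \<beta> ?v y} \<in> edges H"
    then show "x = x'"
      using cover_matching_unique[OF c _ _ e \<beta>L[OF v] \<beta>L[OF u] \<beta>L[OF u], of y x x'] u v
      by (intro \<beta>inj[OF u]) (auto simp: insert_commute)
  qed simp
  then obtain \<sigma> where \<sigma>: "\<And>u. u < n \<Longrightarrow> bij_betw (\<sigma> u) {..<q} {..<q}"
    and \<sigma>_edge: "\<And>u x y. \<lbrakk>u < n; x < q; y < q; {\<beta> u x, \<beta> (Suc u mod n) y} \<in> edges H\<rbrakk> \<Longrightarrow> y = \<sigma> u x"
    by (metis lessThan_iff)
  let ?\<phi> = "\<lambda>f. restrict (\<lambda>v. \<beta> v (f v)) {..<n}"
  have "card (cycle_colorings {..<q} \<sigma> n) \<le> card (cover_transversals ?G L H)"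
  proof (rule card_inj_on_le[of ?\<phi>])
    show "inj_on ?\<phi> (cycle_colorings {..<q} \<sigma> n)"
    proof (rule inj_onI)
      fix f h assume fh: "f \<in> cycle_colorings {..<q} \<sigma> n" "h \<in> cycle_colorings {..<q} \<sigma> n"
        and eq: "?\<phi> f = ?\<phi> h"
      have f: "f \<in> {..<n} \<rightarrow>\<^sub>E {..<q}" and h: "h \<in> {..<n} \<rightarrow>\<^sub>E {..<q}"
        using fh by (auto simp: cycle_colorings_def)
      show "f = h"
      proof (rule PiE_ext[OF f h])
        fix v assume v: "v \<in> {..<n}"
        then have "\<beta> v (f v) = \<beta> v (h v)" using fun_cong[OF eq, of v] by simp
        then show "f v = h v"
          using \<beta>inj[of v "f v" "h v"] PiE_mem[OF f v] PiE_mem[OF h v] v by simp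
      qed
    qed
    show "finite (cover_transversals ?G L H)"
    proof (rule finite_subset)
      show "cover_transversals ?G L H \<subseteq> PiE {..<n} L" by (auto simp: cover_transversals_def)
      show "finite (PiE {..<n} L)" using finL by (intro finite_PiE) auto
    qed
    show "?\<phi> ` cycle_colorings {..<q} \<sigma> n \<subseteq> cover_transversals ?G L H"
    proof (rule image_subsetI)
      fix f assume f: "f \<in> cycle_colorings {..<q} \<sigma> n"
      then have fq: "f v < q" if "v < n" for v
        using that by (auto simp: cycle_colorings_def)
      have step: "{\<beta> u (f u), \<beta> (Suc u mod n) (f (Suc u mod n))} \<notin> edges H" if "u < n" for u
      proof
        assume "{\<beta> u (f u), \<beta> (Suc u mod n) (f (Suc u mod n))} \<in> edges H"
        then have "f (Suc u mod n) = \<sigma> u (f u)"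
          using that fq by (intro \<sigma>_edge) auto
        then show False using f that by (auto simp: cycle_colorings_def)
      qed
      have "{\<beta> u (f u), \<beta> v (f v)} \<notin> edges H" if uv: "u < n" "v < n" for u v
      proof
        assume e: "{\<beta> u (f u), \<beta> v (f v)} \<in> edges H"
        show False
        proof (cases "u = v")
          case True
          then show False using simpleH(2)[OF e] by simp
        next
          case False
          then have "{u, v} \<in> edges ?G"
            using is_coverD(6)[OF c _ _ False \<beta>L \<beta>L e] uv fq by simp
          then consider "v = Suc u mod n" | "u = Suc v mod n"
            using uv cycle_edge_iff by blast
          then show False
            using e step[OF uv(1)] step[OF uv(2)] by cases (auto simp: insert_commute)
        qed
      qed
      then show "?\<phi> f \<in> cover_transversals ?G L H"
        using \<beta>L fq by (auto simp: cover_transversals_def)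
    qed
  qed
  also have "\<dots> = card (cover_colorings ?G H)"
    by (rule bij_betw_same_card[OF cover_colorings_transversals[OF c fin]])
  finally have "card (cycle_colorings {..<q} \<sigma> n) \<le> card (cover_colorings ?G H)" .
  moreover have "(int q - 1) ^ n - 1 \<le> int (card (cycle_colorings {..<q} \<sigma> n))"
    using n \<sigma> by (intro card_cycle_colorings_ge) auto
  ultimately show ?thesis by linarith
qed

text \<open>The cover twisted by a shift on the closing edge attains the lower bound that holds for
  all covers.\<close>

lemma P_DP_even_cycle:
  assumes n: "even n" "3 \<le> n" and q: "2 \<le> q"
  shows "int (P_DP (cycle_graph n) q) = (int q - 1) ^ n - 1"
proof -
  let ?G = "cycle_graph n" and ?C = "{0..<int q}" and ?D = "\<lambda>u v. v = Suc u mod n"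
  define \<sigma> where "\<sigma> = twist_last n (\<lambda>x. (x + 1) mod int q)"
  interpret orientation ?G ?D using n by (intro orientation_cycle)
  have inj: "inj_on (\<sigma> u) ?C" for u
    using bij_betw_twist_last[OF bij_betw_add_mod[of "int q" 1], of n u] q
    by (simp add: \<sigma>_def bij_betw_def)
  have C: "finite ?C" "?C \<noteq> {}" using q by auto
  let ?H = "labelled_cover ?G ?C ?D (\<lambda>u v. \<sigma> u)"
  have "is_fold_cover q ?G (\<lambda>v. {v} \<times> ?C) ?H"
    using labelled_cover_is_cover[OF C inj] by simp
  \<comment> \<open>\<open>P_DP\<close> ranges over covers on natural numbers, so the twisted cover
    is transferred to them.\<close>
  from fold_cover_nat[OF this] obtain L' :: "nat \<Rightarrow> nat set" and H' where
    H': "is_fold_cover q ?G L' H'" "card (cover_colorings ?G H') = card (cover_colorings ?G ?H)"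
    by blast
  have "card (cover_colorings ?G ?H) = card (cycle_colorings ?C \<sigma> n)"
    using labelled_cover_colorings(1)[OF C inj] labelled_colorings_cycle[of n ?C \<sigma>] n by simp
  then have card_H': "int (card (cover_colorings ?G H')) = (int q - 1) ^ n - 1"
    using card_twisted_cycle_colorings(2)[of n q] n q H'(2) by (simp add: \<sigma>_def)
  have "P_DP ?G q = card (cover_colorings ?G H')"
    unfolding P_DP_def
  proof (rule Least_equality)
    show "\<exists>(L :: nat \<Rightarrow> nat set) H. is_fold_cover q ?G L H \<and>
        card (cover_colorings ?G H) = card (cover_colorings ?G H')"
      using H'(1) by blast
  next
    fix y assume "\<exists>(L :: nat \<Rightarrow> nat set) H. is_fold_cover q ?G L H \<and> card (cover_colorings ?G H) = y"
    then obtain L :: "nat \<Rightarrow> nat set" and H where "is_fold_cover q ?G L H" "card (cover_colorings ?G H) = y"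
      by blast
    then show "card (cover_colorings ?G H') \<le> y"
      using card_cycle_cover_colorings_ge[of q n L H] n card_H' by linarith
  qed
  then show ?thesis using card_H' by simp
qed

section \<open>Degeneracy of the product\<close>

lemma simple_graph_cartesian_product:
  assumes "simple_graph G" "simple_graph H"
  shows "simple_graph (G \<box> H)"
proof -
  have G: "finite (verts G)" "\<And>a b. {a, b} \<in> edges G \<Longrightarrow> a \<in> verts G \<and> b \<in> verts G \<and> a \<noteq> b"
    and H: "finite (verts H)" "\<And>a b. {a, b} \<in> edges H \<Longrightarrow> a \<in> verts H \<and> b \<in> verts H \<and> a \<noteq> b"
    using assms by (force simp: simple_graph_def)+
  have "e \<subseteq> verts (G \<box> H) \<and> card e = 2" if "e \<in> edges (G \<box> H)" for e
  proof -
    from that have "\<exists>u v u' v'. e = {(u, v), (u', v')} \<and>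
        (u = u' \<and> u \<in> verts G \<and> {v, v'} \<in> edges H \<or> v = v' \<and> v \<in> verts H \<and> {u, u'} \<in> edges G)"
      by (simp add: cartesian_product_def)
    then obtain u v u' v' where e: "e = {(u, v), (u', v')}"
      "u = u' \<and> u \<in> verts G \<and> {v, v'} \<in> edges H \<or> v = v' \<and> v \<in> verts H \<and> {u, u'} \<in> edges G"
      by blast
    then have "(u, v) \<noteq> (u', v')" "u \<in> verts G" "u' \<in> verts G" "v \<in> verts H" "v' \<in> verts H"
      using G(2)[of u u'] H(2)[of v v'] by auto
    then show ?thesis using e(1) by (simp add: cartesian_product_def)
  qed
  then show ?thesis using G(1) H(1) by (simp add: simple_graph_def cartesian_product_def)
qed

lemma cartesian_product_edge_iff:
  "{(u, v), (u', v')} \<in> edges (G \<box> H) \<longleftrightarrow>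
     u = u' \<and> u \<in> verts G \<and> {v, v'} \<in> edges H \<or> v = v' \<and> v \<in> verts H \<and> {u, u'} \<in> edges G"
  (is "?e \<in> _ \<longleftrightarrow> ?R")
proof
  assume "?e \<in> edges (G \<box> H)"
  then have "\<exists>a b a' b'. ?e = {(a, b), (a', b')} \<and>
      (a = a' \<and> a \<in> verts G \<and> {b, b'} \<in> edges H \<or> b = b' \<and> b \<in> verts H \<and> {a, a'} \<in> edges G)"
    by (simp add: cartesian_product_def)
  then obtain a b a' b' where *: "?e = {(a, b), (a', b')}"
      "a = a' \<and> a \<in> verts G \<and> {b, b'} \<in> edges H \<or> b = b' \<and> b \<in> verts H \<and> {a, a'} \<in> edges G"
    by blast
  from *(1) have "u = a \<and> v = b \<and> u' = a' \<and> v' = b' \<or> u = a' \<and> v = b' \<and> u' = a \<and> v' = b"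
    by (simp add: doubleton_eq_iff)
  then show ?R using *(2) by (auto simp: insert_commute)
next
  assume ?R
  then show "?e \<in> edges (G \<box> H)" unfolding cartesian_product_def by simp blast
qed

lemma verts_cartesian_product [simp]: "verts (G \<box> H) = verts G \<times> verts H"
  by (simp add: cartesian_product_def)

lemma verts_complete_bipartite [simp]: "verts (complete_bipartite k t) = Inl ` {..<k} \<union> Inr ` {..<t}"
  by (simp add: complete_bipartite_def)

lemma complete_bipartite_edge_iff:
  "{Inl i, Inr j} \<in> edges (complete_bipartite k t) \<longleftrightarrow> i < k \<and> j < t"
  "{Inr j, Inl i} \<in> edges (complete_bipartite k t) \<longleftrightarrow> i < k \<and> j < t"
  "{Inl i, Inl i'} \<notin> edges (complete_bipartite k t)"
  "{Inr j, Inr j'} \<notin> edges (complete_bipartite k t)"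
  by (auto simp: complete_bipartite_def doubleton_eq_iff)

lemma simple_graph_complete_bipartite: "simple_graph (complete_bipartite k t)"
  by (auto simp: simple_graph_def complete_bipartite_def)

text \<open>A vertex of \<open>S\<close> over the side of size \<open>t\<close> has at most two
  neighbours along its cycle and \<open>k\<close> across. If \<open>S\<close> has no such vertex,
  only neighbours along the cycle remain.\<close>

lemma cycle_box_complete_bipartite_degenerate:
  assumes S: "S \<subseteq> verts (cycle_graph n \<box> complete_bipartite k t)" "S \<noteq> {}"
  shows "\<exists>v\<in>S. card {u \<in> S. {u, v} \<in> edges (cycle_graph n \<box> complete_bipartite k t)} < k + 3"
proof -
  let ?G = "cycle_graph n \<box> complete_bipartite k t"
  show ?thesis
  proof (cases "\<exists>a j. (a, Inr j) \<in> S")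
    case True
    then obtain a j where aj: "(a, Inr j) \<in> S" by blast
    then have a: "a < n" using S by auto
    let ?N = "{u. u < n \<and> {u, a} \<in> edges (cycle_graph n)}"
    let ?A = "(\<lambda>u. (u, Inr j)) ` ?N :: (nat \<times> (nat + nat)) set" and ?B = "(\<lambda>i. (a, Inl i)) ` {..<k} :: (nat \<times> (nat + nat)) set"
    have "{u \<in> S. {u, (a, Inr j)} \<in> edges ?G} \<subseteq> ?A \<union> ?B"
    proof (rule subsetI)
      fix w assume w: "w \<in> {u \<in> S. {u, (a, Inr j)} \<in> edges ?G}"
      obtain u s where us: "w = (u, s)" by (cases w)
      have "u < n" using w us S by auto
      then show "w \<in> ?A \<union> ?B"
        using w us by (cases s) (auto simp: cartesian_product_edge_iff complete_bipartite_edge_iff)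
    qed
    then have "card {u \<in> S. {u, (a, Inr j)} \<in> edges ?G} \<le> card (?A \<union> ?B)"
      by (intro card_mono) auto
    also have "\<dots> \<le> card ?A + card ?B" by (rule card_Un_le)
    also have "\<dots> \<le> card ?N + card {..<k}"
      by (intro add_mono card_image_le) auto
    also have "\<dots> < k + 3" using card_cycle_neighbours[OF a] by simp
    finally show ?thesis using aj by blast
  next
    case False
    obtain a s where as: "(a, s) \<in> S" using S(2) by auto
    obtain i where i: "s = Inl i" using False as by (cases s) auto
    have a: "a < n" using S as by auto
    let ?N = "{u. u < n \<and> {u, a} \<in> edges (cycle_graph n)}"
    let ?A = "(\<lambda>u. (u, Inl i)) ` ?N :: (nat \<times> (nat + nat)) set"
    have "{u \<in> S. {u, (a, s)} \<in> edges ?G} \<subseteq> ?A"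
    proof (rule subsetI)
      fix w assume w: "w \<in> {u \<in> S. {u, (a, s)} \<in> edges ?G}"
      obtain u r where us: "w = (u, r)" by (cases w)
      have "u < n" using w us S by auto
      then show "w \<in> ?A"
        using w us i False by (cases r) (auto simp: cartesian_product_edge_iff complete_bipartite_edge_iff)
    qed
    then have "card {u \<in> S. {u, (a, s)} \<in> edges ?G} \<le> card ?A"
      by (intro card_mono) auto
    also have "\<dots> \<le> card ?N" by (rule card_image_le) simp
    also have "\<dots> < k + 3" using card_cycle_neighbours[OF a] by simp
    finally show ?thesis using as by blast
  qed
qed

section \<open>Covering by translates\<close>

text \<open>Double counting of the pairs \<open>(s, a)\<close> with \<open>P s a\<close>: if every
  \<open>a\<close> stayed below the average, the total would be too small.\<close>

lemma exists_averaging_choice: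
  assumes fin: "finite S" "finite Y" "Y \<noteq> {}"
    and \<kappa>: "\<And>s. s \<in> S \<Longrightarrow> card {a \<in> Y. P s a} = \<kappa>"
  shows "\<exists>a\<in>Y. card S * \<kappa> \<le> card {s \<in> S. P s a} * card Y"
proof (rule ccontr)
  assume "\<not> ?thesis"
  then have "card {s \<in> S. P s a} * card Y < card S * \<kappa>" if "a \<in> Y" for a
    using that by (meson not_le)
  then have "(\<Sum>a\<in>Y. card {s \<in> S. P s a} * card Y) < (\<Sum>a\<in>Y. card S * \<kappa>)"
    using fin by (intro sum_strict_mono) auto
  moreover have "(\<Sum>a\<in>Y. card {s \<in> S. P s a}) = \<kappa> * card S"
    using sum_multicount[of Y S "\<lambda>a s. P s a" \<kappa>] fin \<kappa> by simp
  ultimately have "\<kappa> * card S * card Y < card Y * (card S * \<kappa>)"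
    by (simp add: sum_distrib_right[symmetric])
  then show False by (simp add: mult_ac)
qed

text \<open>Each greedy choice reduces the uncovered set to at most the fraction
  \<open>1 - \<kappa> / card Y\<close>. Multiplication by \<open>card Y ^ c\<close> keeps the
  statement in the natural numbers.\<close>

lemma greedy_covering_bound:
  assumes fin: "finite X" "finite Y" "Y \<noteq> {}"
    and \<kappa>: "\<And>s. s \<in> X \<Longrightarrow> card {a \<in> Y. P s a} = \<kappa>" and "\<kappa> \<le> card Y"
  shows "\<exists>A. (\<forall>l. A l \<in> Y) \<and>
    card {s \<in> X. \<forall>l<c. \<not> P s (A l)} * card Y ^ c \<le> card X * (card Y - \<kappa>) ^ c"
proof (induction c)
  case 0
  obtain a where "a \<in> Y" using fin(3) by blast
  then show ?case by (intro exI[of _ "\<lambda>_. a"]) simp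
next
  case (Suc c)
  then obtain A where A: "\<forall>l. A l \<in> Y"
    "card {s \<in> X. \<forall>l<c. \<not> P s (A l)} * card Y ^ c \<le> card X * (card Y - \<kappa>) ^ c" by blast
  define S where "S = {s \<in> X. \<forall>l<c. \<not> P s (A l)}"
  have S: "finite S" "S \<subseteq> X" using fin by (auto simp: S_def)
  obtain a where a: "a \<in> Y" "card S * \<kappa> \<le> card {s \<in> S. P s a} * card Y"
    using exists_averaging_choice[OF S(1) fin(2,3), of P \<kappa>] \<kappa> S(2) by blast
  let ?A = "A(c := a)"
  have "{s \<in> X. \<forall>l<Suc c. \<not> P s (?A l)} = S - {s \<in> S. P s a}"
    by (auto simp: S_def less_Suc_eq)
  then have "card {s \<in> X. \<forall>l<Suc c. \<not> P s (?A l)} = card S - card {s \<in> S. P s a}"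
    using S(1) by (simp add: card_Diff_subset)
  then have "card {s \<in> X. \<forall>l<Suc c. \<not> P s (?A l)} * card Y
      = card S * card Y - card {s \<in> S. P s a} * card Y"
    by (simp add: diff_mult_distrib)
  also have "\<dots> \<le> card S * card Y - card S * \<kappa>"
    using a(2) by (rule diff_le_mono2)
  finally have "card {s \<in> X. \<forall>l<Suc c. \<not> P s (?A l)} * card Y \<le> card S * (card Y - \<kappa>)"
    by (simp add: diff_mult_distrib2)
  then have "card {s \<in> X. \<forall>l<Suc c. \<not> P s (?A l)} * card Y * card Y ^ c
      \<le> card S * (card Y - \<kappa>) * card Y ^ c"
    by (rule mult_right_mono) simp
  also have "\<dots> = (card S * card Y ^ c) * (card Y - \<kappa>)" by (simp add: mult_ac)
  also have "\<dots> \<le> (card X * (card Y - \<kappa>) ^ c) * (card Y - \<kappa>)"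
    using A(2) unfolding S_def by (rule mult_right_mono) simp
  finally have "card {s \<in> X. \<forall>l<Suc c. \<not> P s (?A l)} * card Y ^ Suc c
      \<le> card X * (card Y - \<kappa>) ^ Suc c" by (simp add: mult_ac)
  moreover have "\<forall>l. ?A l \<in> Y" using A a by simp
  ultimately show ?case by blast
qed

text \<open>The hypothesis on \<open>c\<close> only bounds the number of uncovered points after \<open>c\<close> greedy steps by
  \<open>1\<close>. Since less than half of the points are covered at a time, at most one point is already left
  after \<open>c - 1\<close> steps, and the last step covers it.\<close>

lemma greedy_covering:
  assumes X: "finite X" and Y: "finite Y" "Y \<noteq> {}" and card_eq: "card X = card Y"
    and \<kappa>: "\<And>s. s \<in> X \<Longrightarrow> card {a \<in> Y. P s a} = \<kappa>" and "0 < \<kappa>" "2 * \<kappa> < card Y"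
    and c: "0 < c" "card Y * (card Y - \<kappa>) ^ c \<le> card Y ^ c"
  shows "\<exists>A. (\<forall>l. A l \<in> Y) \<and> (\<forall>s\<in>X. \<exists>l<c. P s (A l))"
proof -
  obtain b where b: "c = Suc b" using c(1) gr0_conv_Suc by blast
  let ?N = "card Y" and ?M = "card Y - \<kappa>"
  obtain A where A: "\<forall>l. A l \<in> Y" "card {s \<in> X. \<forall>l<b. \<not> P s (A l)} * ?N ^ b \<le> card X * ?M ^ b"
    using greedy_covering_bound[OF X Y \<kappa>, where c = b] \<open>2 * \<kappa> < ?N\<close> by force
  define S where "S = {s \<in> X. \<forall>l<b. \<not> P s (A l)}"
  have N: "0 < ?N" using \<open>2 * \<kappa> < ?N\<close> by linarith
  \<comment> \<open>The hypothesis speaks of \<open>c = Suc b\<close> steps, so the bound after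
    \<open>b\<close> steps is multiplied by the missing factor \<open>?M\<close>. This leaves
    \<open>card S * ?M \<le> ?N\<close>, and two points in \<open>S\<close> would contradict
    \<open>2 * \<kappa> < ?N\<close>.\<close>
  have "card S * ?M * ?N ^ b \<le> card X * ?M ^ b * ?M"
    using mult_right_mono[OF A(2), of ?M] by (simp add: S_def mult_ac)
  also have "\<dots> \<le> ?N * ?N ^ b" using c(2) by (simp add: b card_eq mult_ac)
  finally have "card S * ?M \<le> ?N" using N by simp
  then have le1: "card S \<le> 1"
  proof (rule contrapos_pp)
    assume "\<not> card S \<le> 1"
    then have "2 * ?M \<le> card S * ?M" by (intro mult_right_mono) auto
    then show "\<not> card S * ?M \<le> ?N" using \<open>2 * \<kappa> < ?N\<close> by linarith
  qed
  have "finite S" using X by (simp add: S_def)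
  have "\<exists>a\<in>Y. \<forall>s\<in>S. P s a"
  proof (cases "S = {}")
    case True
    then show ?thesis using Y by blast
  next
    case False
    then have "card S = 1" using le1 \<open>finite S\<close> by (simp add: le_Suc_eq)
    then obtain s where s: "S = {s}" by (auto simp: card_1_singleton_iff)
    then have "card {a \<in> Y. P s a} = \<kappa>" using \<kappa> by (auto simp: S_def)
    then have "{a \<in> Y. P s a} \<noteq> {}" using \<open>0 < \<kappa>\<close> by force
    then show ?thesis using s by blast
  qed
  then obtain a where a: "a \<in> Y" "\<forall>s\<in>S. P s a" by blast
  have "\<exists>l<c. P s ((A(b := a)) l)" if s: "s \<in> X" for s
  proof (cases "s \<in> S")
    case True
    then show ?thesis using a by (intro exI[of _ b]) (simp add: b)
  next
    case False
    then obtain l where "l < b" "P s (A l)" using s by (auto simp: S_def)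
    then show ?thesis by (intro exI[of _ l]) (simp add: b)
  qed
  then show ?thesis using A(1) a(1) by (intro exI[of _ "A(b := a)"]) auto
qed

section \<open>Words of labels that block a copy of the cycle\<close>

text \<open>The pairs exchanged by the involution on the closing edge. For odd \<open>k + 2\<close>
  the pairs inside \<open>{0..<int (k + 2)}\<close> miss the last label.\<close>

definition label_pair :: "nat \<Rightarrow> int set" where
  "label_pair p = {2 * int p, 2 * int p + 1}"

text \<open>The words whose entries leave exactly a pair of labels exchanged by \<open>pair_swap\<close> below.\<close>

definition blocking_words :: "nat \<Rightarrow> (nat \<Rightarrow> int) set" where
  "blocking_words k = (\<Union>p<(k + 2) div 2.
     {z \<in> {..<k} \<rightarrow>\<^sub>E {0..<int (k + 2)} - label_pair p. inj_on z {..<k}})"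

lemma card_complement_label_pair:
  assumes "p < (k + 2) div 2"
  shows "label_pair p \<subseteq> {0..<int (k + 2)}" "card ({0..<int (k + 2)} - label_pair p) = k"
proof -
  show "label_pair p \<subseteq> {0..<int (k + 2)}" using assms by (auto simp: label_pair_def)
  moreover have "card (label_pair p) = 2" by (simp add: label_pair_def)
  ultimately show "card ({0..<int (k + 2)} - label_pair p) = k"
    by (simp add: card_Diff_subset label_pair_def)
qed

lemma blocking_word_image:
  assumes "p < (k + 2) div 2" "z \<in> {..<k} \<rightarrow>\<^sub>E {0..<int (k + 2)} - label_pair p" "inj_on z {..<k}"
  shows "z ` {..<k} = {0..<int (k + 2)} - label_pair p"
proof (rule card_subset_eq)
  show "z ` {..<k} \<subseteq> {0..<int (k + 2)} - label_pair p"
    using PiE_mem[OF assms(2)] by blast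
  show "card (z ` {..<k}) = card ({0..<int (k + 2)} - label_pair p)"
    using card_complement_label_pair(2)[OF assms(1)] assms(3) by (simp add: card_image)
qed simp

text \<open>For each of the \<open>(k + 2) div 2\<close> pairs, the words are the bijections onto
  its complement, which has \<open>k\<close> elements. The range of a word determines its pair, so
  these sets of words are disjoint.\<close>

lemma card_blocking_words: "card (blocking_words k) = (k + 2) div 2 * fact k"
proof -
  let ?W = "\<lambda>p. {z \<in> {..<k} \<rightarrow>\<^sub>E {0..<int (k + 2)} - label_pair p. inj_on z {..<k}}"
  have "card (?W p) = fact k" if "p < (k + 2) div 2" for p
    using card_inj_on_subset_funcset[of "{..<k}" "{0..<int (k + 2)} - label_pair p" "{..<k}"]
      card_complement_label_pair(2)[OF that] by (simp add: fact_prod_rev)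
  moreover have "?W p \<inter> ?W p' = {}" if p: "p < (k + 2) div 2" "p' < (k + 2) div 2" "p \<noteq> p'" for p p'
  proof (rule ccontr)
    assume "?W p \<inter> ?W p' \<noteq> {}"
    then obtain z where "z \<in> ?W p" "z \<in> ?W p'" by blast
    then have "{0..<int (k + 2)} - label_pair p = {0..<int (k + 2)} - label_pair p'"
      using blocking_word_image[of p k z] blocking_word_image[of p' k z] p by auto
    then have "label_pair p = label_pair p'"
      using card_complement_label_pair(1)[OF p(1)] card_complement_label_pair(1)[OF p(2)] by blast
    then have "2 * int p \<in> label_pair p'" by (auto simp: label_pair_def)
    then show False using p(3) by (auto simp: label_pair_def)
  qed
  moreover have "finite (?W p)" for p
    by (rule finite_subset[of _ "{..<k} \<rightarrow>\<^sub>E {0..<int (k + 2)} - label_pair p"]) (auto intro: finite_PiE)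
  ultimately show ?thesis
    unfolding blocking_words_def by (subst card_UN_disjoint) auto
qed

text \<open>If \<open>s\<close> lists the labels of the \<open>k\<close> colorings at vertex
  \<open>0\<close> and \<open>a\<close> the offsets attached to a copy on the other side, this is
  the word of labels forbidden on that copy.\<close>

definition translate :: "nat \<Rightarrow> (nat \<Rightarrow> int) \<Rightarrow> (nat \<Rightarrow> int) \<Rightarrow> nat \<Rightarrow> int" where
  "translate k s a = (\<lambda>i\<in>{..<k}. (s i + a i) mod int (k + 2))"

text \<open>Adding \<open>s\<close> permutes the words, so every \<open>s\<close> is sent into
  \<open>K\<close> by the same number of offsets. This is the regularity that the averaging
  needs.\<close>

lemma card_translate_preimage:
  fixes k :: nat and s :: "nat \<Rightarrow> int"
  defines "X \<equiv> {..<k} \<rightarrow>\<^sub>E {0..<int (k + 2)}"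
  assumes K: "K \<subseteq> X"
  shows "card {a \<in> X. translate k s a \<in> K} = card K"
proof (rule bij_betw_same_card[of "translate k s"],
    rule bij_betw_byWitness[where f' = "translate k (\<lambda>i. - s i)"])
  have inv: "translate k (\<lambda>i. - s i) (translate k s a) = a"
    and inv': "translate k s (translate k (\<lambda>i. - s i) a) = a" if "a \<in> X" for a
  proof -
    have a: "0 \<le> a i \<and> a i < int (k + 2)" if "i < k" for i
      using PiE_mem[of a "{..<k}" _ i] \<open>a \<in> X\<close> that by (auto simp: X_def)
    have u: "a i = undefined" if "\<not> i < k" for i
      using PiE_arb[of a "{..<k}" _ i] \<open>a \<in> X\<close> that by (auto simp: X_def)
    have m: "((x + y) mod q - x) mod q = y mod q" "(x + (y - x) mod q) mod q = y mod q"
      for x y q :: int by (simp_all add: mod_diff_left_eq mod_add_right_eq)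
    show "translate k (\<lambda>i. - s i) (translate k s a) = a"
      "translate k s (translate k (\<lambda>i. - s i) a) = a"
      using a u by (auto simp: translate_def fun_eq_iff m)
  qed
  have X: "translate k r a \<in> X" for r a by (auto simp: translate_def X_def)
  show "\<forall>a\<in>{a \<in> X. translate k s a \<in> K}. translate k (\<lambda>i. - s i) (translate k s a) = a"
    using inv by blast
  show "\<forall>a\<in>K. translate k s (translate k (\<lambda>i. - s i) a) = a" using inv' K by blast
  show "translate k s ` {a \<in> X. translate k s a \<in> K} \<subseteq> K" by blast
  show "translate k (\<lambda>i. - s i) ` K \<subseteq> {a \<in> X. translate k s a \<in> K}"
    using X inv' K by (auto simp: subset_iff)
qed

text \<open>Follows from \<open>2 * ((k + 2) div 2) \<le> k + 2\<close> and
  \<open>fact k \<le> k ^ (k - 1)\<close>. For \<open>k = 1\<close> the exponent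
  \<open>k - 1\<close> vanishes and gives no strictness, so this case is checked directly.\<close>

lemma two_blocking_words_less:
  assumes "1 \<le> k"
  shows "2 * ((k + 2) div 2 * fact k) < (k + 2) ^ k"
proof (cases "k = 1")
  case False
  then obtain j where j: "k = Suc (Suc j)"
    using assms by (metis One_nat_def Suc_le_D not0_implies_Suc le_zero_eq not_less_eq_eq)
  have *: "fact (Suc i) \<le> Suc i ^ i" for i :: nat
  proof (induction i)
    case (Suc i)
    have "fact (Suc (Suc i)) = Suc (Suc i) * fact (Suc i)" by simp
    also have "\<dots> \<le> Suc (Suc i) * Suc i ^ i" using Suc.IH by (rule mult_left_mono) simp
    also have "\<dots> \<le> Suc (Suc i) * Suc (Suc i) ^ i" by (intro mult_left_mono power_mono) auto
    finally show ?case by simp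
  qed simp
  have "2 * ((k + 2) div 2 * fact k) = 2 * ((k + 2) div 2) * fact k" by simp
  also have "\<dots> \<le> (k + 2) * fact k"
    by (intro mult_right_mono) auto
  also have "\<dots> \<le> (k + 2) * k ^ Suc j"
    using *[of "Suc j"] unfolding j by (rule mult_left_mono) simp
  also have "\<dots> < (k + 2) * (k + 2) ^ Suc j"
    by (intro mult_strict_left_mono power_strict_mono) auto
  finally show ?thesis by (simp add: j)
qed simp

section \<open>The constant \<open>c_const\<close> and the covering of all words\<close>

text \<open>With \<open>M = N - \<kappa>\<close>, the second bound is
  \<open>ln N \<le> c * (ln N - ln M)\<close> in exponential form, and \<open>c_const k\<close> is
  the least integer \<open>c\<close> with this property.\<close>

lemma c_const_bounds:
  assumes "1 \<le> k"
  defines "N \<equiv> (k + 2) ^ k" and "\<kappa> \<equiv> (k + 2) div 2 * fact k"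
  shows "0 < c_const k" "N * (N - \<kappa>) ^ nat (c_const k) \<le> N ^ nat (c_const k)"
proof -
  have lt: "2 * \<kappa> < N" using two_blocking_words_less[OF assms(1)] by (simp add: N_def \<kappa>_def)
  have \<kappa>: "0 < \<kappa>" by (simp add: \<kappa>_def)
  define M where "M = N - \<kappa>"
  have M: "0 < M" "M < N" "real M = real N - real \<kappa>"
    using lt \<kappa> by (auto simp: M_def)
  have N1: "1 < N" using lt \<kappa> by linarith
  have "real_of_int \<lfloor>(real k + 2) / 2\<rfloor> = real ((k + 2) div 2)"
    using floor_divide_of_nat_eq[of "k + 2" 2, where ?'a = real]
    by (simp add: add.commute)
  then have "(real k + 2) ^ k - of_int \<lfloor>(real k + 2) / 2\<rfloor> * fact k = real M"
    by (simp add: M(3) N_def \<kappa>_def add.commute distrib_right)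
  moreover have lnN: "real k * ln (real k + 2) = ln (real N)"
    by (simp add: N_def ln_realpow add.commute)
  ultimately have c: "c_const k = \<lceil>ln (real N) / (ln (real N) - ln (real M))\<rceil>"
    by (simp add: c_const_def)
  have d: "0 < ln (real N) - ln (real M)" using M by simp
  have pos: "0 < ln (real N) / (ln (real N) - ln (real M))" using d N1 by simp
  then show c0: "0 < c_const k" unfolding c by (simp only: zero_less_ceiling)
  let ?c = "nat (c_const k)"
  have "ln (real N) / (ln (real N) - ln (real M)) \<le> real ?c"
    using c0 unfolding c by (metis le_of_int_ceiling of_nat_nat less_imp_le of_int_of_nat_eq)
  then have "ln (real N) \<le> real ?c * (ln (real N) - ln (real M))"
    using d by (simp add: pos_divide_le_eq)
  then have "ln (real N) + real ?c * ln (real M) \<le> real ?c * ln (real N)"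
    by (simp add: algebra_simps)
  then have "ln (real N * real M ^ ?c) \<le> ln (real N ^ ?c)"
    using M N1 by (simp add: ln_mult ln_realpow)
  then have "real N * real M ^ ?c \<le> real N ^ ?c"
    using M N1 by (subst (asm) ln_le_cancel_iff) auto
  then have "real (N * M ^ ?c) \<le> real (N ^ ?c)" by simp
  then show "N * (N - \<kappa>) ^ ?c \<le> N ^ ?c"
    unfolding M_def[symmetric] by (simp only: of_nat_le_iff)
qed

lemma blocking_translates_cover:
  assumes "1 \<le> k"
  shows "\<exists>A. \<forall>s\<in>{..<k} \<rightarrow>\<^sub>E {0..<int (k + 2)}. \<exists>l<nat (c_const k). translate k s (A l) \<in> blocking_words k"
proof -
  let ?X = "{..<k} \<rightarrow>\<^sub>E {0..<int (k + 2)}"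
  have cardX: "card ?X = (k + 2) ^ k" by (simp add: card_funcsetE nat_add_distrib)
  have X: "finite ?X" by (intro finite_PiE) auto
  have sub: "blocking_words k \<subseteq> ?X" unfolding blocking_words_def using PiE_mono[of "{..<k}" _ "\<lambda>_. {0..<int (k + 2)}"] by blast
  have ne: "?X \<noteq> {}" using cardX by force
  have "\<exists>A. (\<forall>l. A l \<in> ?X) \<and>
      (\<forall>s\<in>?X. \<exists>l<nat (c_const k). translate k s (A l) \<in> blocking_words k)"
  proof (rule greedy_covering[OF X X ne refl, where \<kappa> = "(k + 2) div 2 * fact k"])
    show "card {a \<in> ?X. translate k s a \<in> blocking_words k} = (k + 2) div 2 * fact k" for s
      using card_translate_preimage[OF sub] card_blocking_words by simp
    show "2 * ((k + 2) div 2 * fact k) < card ?X"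
      unfolding cardX by (rule two_blocking_words_less[OF assms])
    show "0 < nat (c_const k)" using c_const_bounds(1)[OF assms] by simp
    show "card ?X * (card ?X - (k + 2) div 2 * fact k) ^ nat (c_const k) \<le> card ?X ^ nat (c_const k)"
      unfolding cardX by (rule c_const_bounds(2)[OF assms])
  qed simp
  then show ?thesis by blast
qed

section \<open>An uncolorable cover of the product\<close>

text \<open>Arcs run along the cycles and from the \<open>k\<close> copies to the \<open>t\<close>
  copies, so that a coloring of the former determines the labels forbidden on the latter.\<close>

fun box_arc :: "nat \<Rightarrow> nat \<times> (nat + nat) \<Rightarrow> nat \<times> (nat + nat) \<Rightarrow> bool" where
  "box_arc n (u, Inl i) (v, Inl i') \<longleftrightarrow> i = i' \<and> v = Suc u mod n"
| "box_arc n (u, Inr j) (v, Inr j') \<longleftrightarrow> j = j' \<and> v = Suc u mod n"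
| "box_arc n (u, Inl i) (v, Inr j) \<longleftrightarrow> u = v"
| "box_arc n (u, Inr j) (v, Inl i) \<longleftrightarrow> False"

lemma orientation_box:
  assumes "3 \<le> n"
  shows "orientation (cycle_graph n \<box> complete_bipartite k t) (box_arc n)"
proof
  show "simple_graph (cycle_graph n \<box> complete_bipartite k t)"
    using assms
    by (intro simple_graph_cartesian_product simple_graph_cycle simple_graph_complete_bipartite) simp
next
  fix a b assume ab: "a \<in> verts (cycle_graph n \<box> complete_bipartite k t)"
    "b \<in> verts (cycle_graph n \<box> complete_bipartite k t)" "box_arc n a b"
  obtain u s v r where us: "a = (u, s)" "b = (v, r)" by (cases a, cases b)
  have uv: "u < n" "v < n" using ab us by auto
  show "{a, b} \<in> edges (cycle_graph n \<box> complete_bipartite k t)"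
    using ab us uv
    by (cases s; cases r) (auto simp: cartesian_product_edge_iff complete_bipartite_edge_iff cycle_edge_iff)
  show "\<not> box_arc n b a"
    using ab us uv Suc_Suc_mod_neq[OF assms uv(1)] by (cases s; cases r) auto
qed

text \<open>Exchanges the two labels of each \<open>label_pair\<close> below \<open>q\<close>. The
  guard \<open>x + 1 < q\<close> fixes the last label when \<open>q\<close> is odd.\<close>

definition pair_swap :: "int \<Rightarrow> int \<Rightarrow> int" where
  "pair_swap q x = (if odd x then x - 1 else if x + 1 < q then x + 1 else x)"

lemma bij_betw_pair_swap: "bij_betw (pair_swap q) {0..<q} {0..<q}"
proof (rule bij_betw_byWitness[where f' = "pair_swap q"])
  have "0 < x" if "odd x" "0 \<le> x" for x :: int using that by (cases "x = 0") auto
  then show "pair_swap q ` {0..<q} \<subseteq> {0..<q}" "pair_swap q ` {0..<q} \<subseteq> {0..<q}"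
    by (fastforce simp: pair_swap_def)+
qed (auto simp: pair_swap_def)

text \<open>The \<open>k\<close> copies of the cycle carry the cover with fewest colorings, whose colorings form orbits
  of size \<open>k + 2\<close> under simultaneous shifts. The offset \<open>d u i j\<close> will depend on \<open>u\<close> in such a way
  that every coloring in one chosen orbit of copy \<open>i\<close> forbids the same label at all vertices of copy
  \<open>j\<close> on the other side.\<close>

fun box_map :: "nat \<Rightarrow> int \<Rightarrow> (nat \<Rightarrow> nat \<Rightarrow> nat \<Rightarrow> int) \<Rightarrow> nat \<times> (nat + nat) \<Rightarrow> nat \<times> (nat + nat)
    \<Rightarrow> int \<Rightarrow> int" where
  "box_map n q d (u, Inl i) (v, Inl i') = twist_last n (\<lambda>x. (x + 1) mod q) u"
| "box_map n q d (u, Inr j) (v, Inr j') = twist_last n (pair_swap q) u"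
| "box_map n q d (u, Inl i) (v, Inr j) = (\<lambda>x. (x + d u i j) mod q)"
| "box_map n q d (u, Inr j) (v, Inl i) = id"

lemma bij_betw_box_map: "0 < q \<Longrightarrow> bij_betw (box_map n q d a b) {0..<q} {0..<q}"
  by (cases "(n, q, d, a, b)" rule: box_map.cases)
    (auto intro: bij_betw_twist_last bij_betw_add_mod bij_betw_pair_swap)

text \<open>The two labels alternate along the \<open>n - 1\<close> identity edges. As
  \<open>n - 1\<close> is odd, the ends carry different labels, and the swap on the closing edge
  forbids exactly this.\<close>

lemma no_swapped_even_cycle_coloring:
  assumes n: "even n" "0 < n"
    and f: "\<And>u. u < n \<Longrightarrow> f u \<in> label_pair p" and p: "2 * int p + 1 < q"
    and step: "\<And>u. u < n \<Longrightarrow> f (Suc u mod n) \<noteq> twist_last n (pair_swap q) u (f u)"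
  shows False
proof -
  \<comment> \<open>The labels of the pair sum to \<open>4 * int p + 1\<close>, so subtraction from
    this value gives the other label.\<close>
  have alt: "f u = (if even u then f 0 else 4 * int p + 1 - f 0)" if "u < n" for u
    using that
  proof (induction u)
    case (Suc u)
    have "f (Suc u) \<noteq> f u" using step[of u] Suc.prems by (simp add: twist_last_def)
    moreover have "f 0 \<in> label_pair p" "f u \<in> label_pair p" "f (Suc u) \<in> label_pair p"
      using f Suc.prems n by auto
    ultimately show ?case using Suc by (auto simp: label_pair_def)
  qed simp
  have "odd (n - 1)" using n by simp
  then have "f (n - 1) = 4 * int p + 1 - f 0" using alt[of "n - 1"] n by simp
  moreover have "f 0 \<noteq> pair_swap q (f (n - 1))"
    using step[of "n - 1"] n by (simp add: twist_last_def)
  moreover have "f 0 \<in> label_pair p" using f n by simp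
  ultimately show False using p by (auto simp: label_pair_def pair_swap_def)
qed

text \<open>The matchings commute with simultaneous shifts, so every orbit contains a coloring with
  label \<open>0\<close> at vertex \<open>0\<close>, which serves as its representative.\<close>

lemma cycle_coloring_normalize:
  fixes q :: int
  assumes q: "0 < q" and n: "0 < n"
    and F: "\<And>u. u < n \<Longrightarrow> F u \<in> {0..<q}"
    and step: "\<And>u. u < n \<Longrightarrow> F (Suc u mod n) \<noteq> twist_last n (\<lambda>x. (x + 1) mod q) u (F u)"
  shows "(\<lambda>u\<in>{..<n}. (F u - F 0) mod q) \<in>
    cycle_colorings_from {0..<q} (twist_last n (\<lambda>x. (x + 1) mod q)) n 0"
proof -
  let ?\<sigma> = "twist_last n (\<lambda>x. (x + 1) mod q)"
  have "(F (Suc u mod n) - F 0) mod q \<noteq> ?\<sigma> u ((F u - F 0) mod q)" if u: "u < n" for u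
  proof
    assume eq: "(F (Suc u mod n) - F 0) mod q = ?\<sigma> u ((F u - F 0) mod q)"
    have "?\<sigma> u ((F u - F 0) mod q) = (?\<sigma> u (F u) - F 0) mod q"
    proof (cases "Suc u = n")
      case True
      have "((F u - F 0) mod q + 1) mod q = (F u - F 0 + 1) mod q" by (rule mod_add_left_eq)
      also have "\<dots> = (F u + 1 - F 0) mod q" by (simp add: algebra_simps)
      also have "\<dots> = ((F u + 1) mod q - F 0) mod q" by (rule mod_diff_left_eq[symmetric])
      finally show ?thesis using True by (simp add: twist_last_def)
    qed (simp add: twist_last_def)
    \<comment> \<open>Adding \<open>F 0\<close> back undoes the normalization; both labels are
      reduced residues, so the congruence is an equality.\<close>
    then have "(F (Suc u mod n) - F 0 + F 0) mod q = (?\<sigma> u (F u) - F 0 + F 0) mod q"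
      using eq by (metis mod_add_left_eq)
    moreover have "F (Suc u mod n) \<in> {0..<q}" "?\<sigma> u (F u) \<in> {0..<q}"
      using F[OF u] F[of "Suc u mod n"] n q by (auto simp: twist_last_def)
    ultimately show False using step[OF u] by simp
  qed
  then show ?thesis
    using q n by (auto simp: cycle_colorings_from_def)
qed

text \<open>Each pair of a tuple of orbit representatives and a greedy translate receives its own
  copy on the other side. Every coloring of the \<open>k\<close> copies selects such a pair whose
  copy it blocks.\<close>

lemma box_has_uncolorable_labelling:
  fixes k n t :: nat
  defines "q \<equiv> int (k + 2)"
  defines "Base \<equiv> cycle_colorings_from {0..<q} (twist_last n (\<lambda>x. (x + 1) mod q)) n 0"
  assumes k: "1 \<le> k" and n: "even n" "0 < n" and t: "nat (c_const k) * card Base ^ k \<le> t"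
  shows "\<exists>d. labelled_colorings (cycle_graph n \<box> complete_bipartite k t) {0..<q}
    (box_arc n) (box_map n q d) = {}"
proof -
  let ?c = "nat (c_const k)" and ?\<sigma> = "twist_last n (\<lambda>x. (x + 1) mod q)"
  let ?G = "cycle_graph n \<box> complete_bipartite k t"
  obtain A where A: "\<And>s. s \<in> {..<k} \<rightarrow>\<^sub>E {0..<q} \<Longrightarrow> \<exists>l<?c. translate k s (A l) \<in> blocking_words k"
    using blocking_translates_cover[OF k] unfolding q_def by blast
  define T where "T = ({..<k} \<rightarrow>\<^sub>E Base) \<times> {..<?c}"
  have q: "0 < q" by (simp add: q_def)
  have "finite Base"
    unfolding Base_def cycle_colorings_from_def
    by (rule finite_subset[of _ "{..<n} \<rightarrow>\<^sub>E {0..<q}"]) (auto intro: finite_PiE)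
  then have "finite T" "card T \<le> card {..<t}"
    using t by (auto simp: T_def card_cartesian_product card_funcsetE mult.commute intro!: finite_PiE)
  then obtain e where e: "e ` T \<subseteq> {..<t}" "inj_on e T"
    using card_le_inj[of T "{..<t}"] by auto
  \<comment> \<open>Subtracting \<open>B i u\<close> makes the forbidden label independent of
    \<open>u\<close>, and \<open>A l i\<close> selects the translate. For \<open>j\<close> outside
    the image of \<open>T\<close> under \<open>e\<close> the inverse is arbitrary; the contradiction
    never comes from such copies.\<close>
  define d where "d = (\<lambda>u i j. case inv_into T e j of (B, l) \<Rightarrow> A l i - B i u)"
  have "labelled_colorings ?G {0..<q} (box_arc n) (box_map n q d) = {}"
  proof (rule equals0I)
    fix f assume f: "f \<in> labelled_colorings ?G {0..<q} (box_arc n) (box_map n q d)"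
    have range: "f (u, Inl i) \<in> {0..<q}" if "u < n" "i < k" for u i
      using f that by (auto simp: labelled_colorings_def)
    have range': "f (u, Inr j) \<in> {0..<q}" if "u < n" "j < t" for u j
      using f that by (auto simp: labelled_colorings_def)
    have arc: "f b \<noteq> box_map n q d a b (f a)"
      if "a \<in> verts ?G" "b \<in> verts ?G" "box_arc n a b" for a b
      using f that unfolding labelled_colorings_def by blast
    \<comment> \<open>\<open>B\<close> records the orbits of the \<open>k\<close> colorings and
      \<open>s\<close> the positions inside them; \<open>s\<close> then determines a suitable
      translate \<open>l\<close>.\<close>
    define s where "s = (\<lambda>i\<in>{..<k}. f (0, Inl i))"
    define B where "B = (\<lambda>i\<in>{..<k}. \<lambda>u\<in>{..<n}. (f (u, Inl i) - f (0, Inl i)) mod q)"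
    have "(\<lambda>u\<in>{..<n}. (f (u, Inl i) - f (0, Inl i)) mod q) \<in> Base" if i: "i < k" for i
      unfolding Base_def
    proof (rule cycle_coloring_normalize[OF q n(2), of "\<lambda>u. f (u, Inl i)"])
      fix u assume "u < n"
      then show "f (Suc u mod n, Inl i) \<noteq> ?\<sigma> u (f (u, Inl i))"
        using arc[of "(u, Inl i)" "(Suc u mod n, Inl i)"] i by simp
    qed (use range i in blast)
    then have "B \<in> {..<k} \<rightarrow>\<^sub>E Base" by (auto simp: B_def)
    moreover have "s \<in> {..<k} \<rightarrow>\<^sub>E {0..<q}" using range n by (auto simp: s_def)
    then obtain l where l: "l < ?c" "translate k s (A l) \<in> blocking_words k" using A by blast
    ultimately have T: "(B, l) \<in> T" by (simp add: T_def)
    define j where "j = e (B, l)"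
    have j: "j < t" using e(1) T by (auto simp: j_def)
    have d: "d u i j = A l i - B i u" for u i
      using inv_into_f_f[OF e(2) T] by (simp add: d_def j_def)
    obtain p where p: "p < (k + 2) div 2"
      and z: "translate k s (A l) \<in> {..<k} \<rightarrow>\<^sub>E {0..<int (k + 2)} - label_pair p"
        "inj_on (translate k s (A l)) {..<k}"
      using l(2) unfolding blocking_words_def by blast
    \<comment> \<open>The forbidden word takes every label outside the pair as a value, so only the
      pair is left at each vertex of copy \<open>j\<close>.\<close>
    have "f (u, Inr j) \<in> label_pair p" if u: "u < n" for u
    proof (rule ccontr)
      assume "f (u, Inr j) \<notin> label_pair p"
      then have "f (u, Inr j) \<in> translate k s (A l) ` {..<k}"
        using blocking_word_image[OF p z] range'[OF u j] by (simp add: q_def)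
      then obtain i where i: "i < k" "f (u, Inr j) = (f (0, Inl i) + A l i) mod q"
        by (auto simp: translate_def s_def q_def)
      have "f (u, Inr j) \<noteq> (f (u, Inl i) + d u i j) mod q"
        using arc[of "(u, Inl i)" "(u, Inr j)"] i(1) u j by simp
      moreover have "(f (u, Inl i) + d u i j) mod q = (f (0, Inl i) + A l i) mod q"
      proof -
        have "(f (u, Inl i) + d u i j) mod q
            = (f (u, Inl i) + A l i - (f (u, Inl i) - f (0, Inl i)) mod q) mod q"
          using i(1) u by (simp add: d B_def algebra_simps)
        also have "\<dots> = (f (u, Inl i) + A l i - (f (u, Inl i) - f (0, Inl i))) mod q"
          by (rule mod_diff_right_eq)
        finally show ?thesis by (simp add: algebra_simps)
      qed
      ultimately show False using i(2) by simp
    qed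
    moreover have "f (Suc u mod n, Inr j) \<noteq> twist_last n (pair_swap q) u (f (u, Inr j))"
      if "u < n" for u
      using arc[of "(u, Inr j)" "(Suc u mod n, Inr j)"] that j by simp
    moreover have "2 * int p + 1 < q" using p by (simp add: q_def)
    ultimately show False
      using no_swapped_even_cycle_coloring[OF n, of "\<lambda>u. f (u, Inr j)" p q] by blast
  qed
  then show ?thesis by blast
qed

section \<open>From the uncolorable labelling to the DP-chromatic number\<close>

text \<open>Minimality in \<open>chi_DP\<close> asks for a cover without colorings at every smaller
  positive list size. Keeping the first \<open>y\<close> labels preserves injectivity, and a
  labelled coloring with these labels is also one with all \<open>q\<close> labels.\<close>

lemma uncolorable_labelling_restrict:
  assumes "orientation G D" and "y \<le> q" "0 < y"
    and inj: "\<And>a b. inj_on (g a b) {0..<int q}"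
    and empty: "labelled_colorings G {0..<int q} D g = {}"
  shows "\<exists>(L :: 'a \<Rightarrow> nat set) H. is_fold_cover y G L H \<and> cover_colorings G H = {}"
proof -
  interpret orientation G D by fact
  let ?C = "{0..<int y}"
  have C: "finite ?C" "?C \<noteq> {}" using assms(3) by auto
  have sub: "?C \<subseteq> {0..<int q}" using assms(2) by auto
  have inj': "inj_on (g a b) ?C" for a b using inj_on_subset[OF inj sub] .
  have "labelled_colorings G ?C D g \<subseteq> labelled_colorings G {0..<int q} D g"
    using PiE_mono[of "verts G" "\<lambda>_. ?C" "\<lambda>_. {0..<int q}"] sub
    unfolding labelled_colorings_def by blast
  then have "labelled_colorings G ?C D g = {}" using empty by simp
  then have "cover_colorings G (labelled_cover G ?C D g) = {}"
    using labelled_cover_colorings(2)[OF C inj'] by simp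
  moreover have "is_fold_cover y G (\<lambda>v. {v} \<times> ?C) (labelled_cover G ?C D g)"
    using labelled_cover_is_cover[OF C inj'] by simp
  ultimately show ?thesis using fold_cover_nat[of y G "\<lambda>v. {v} \<times> ?C"] by blast
qed

theorem theorem8:
  fixes k m :: nat
  assumes "k \<ge> 1" and "m \<ge> 1"
  shows "of_int (c_const k) * (real (P_DP (cycle_graph (2 * m + 2)) (k + 2)) / (real k + 2)) ^ k
           = of_int (c_const k) * (((real k + 1) ^ (2 * m + 2) - 1) / (real k + 2)) ^ k
       \<and> (\<forall>t :: nat.
            real t \<ge> of_int (c_const k) *
              (real (P_DP (cycle_graph (2 * m + 2)) (k + 2)) / (real k + 2)) ^ k
            \<longrightarrow> chi_DP (cycle_graph (2 * m + 2) \<box> complete_bipartite k t) = k + 3)"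
proof (intro conjI allI impI)
  define n where "n = 2 * m + 2"
  define q where "q = int (k + 2)"
  define \<sigma> where "\<sigma> = twist_last n (\<lambda>x. (x + 1) mod q)"
  define Base where "Base = cycle_colorings_from {0..<q} \<sigma> n 0"
  have n: "even n" "3 \<le> n" "0 < n" using assms(2) by (auto simp: n_def)
  have P: "int (P_DP (cycle_graph n) (k + 2)) = (q - 1) ^ n - 1"
    unfolding q_def using n by (intro P_DP_even_cycle) auto
  then have "real_of_int (int (P_DP (cycle_graph n) (k + 2))) = real_of_int ((q - 1) ^ n - 1)"
    by (simp only:)
  then have P_real: "real (P_DP (cycle_graph n) (k + 2)) = (real k + 1) ^ n - 1"
    by (simp add: q_def add.commute)
  then show "of_int (c_const k) * (real (P_DP (cycle_graph (2 * m + 2)) (k + 2)) / (real k + 2)) ^ k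
      = of_int (c_const k) * (((real k + 1) ^ (2 * m + 2) - 1) / (real k + 2)) ^ k"
    unfolding n_def[symmetric] by simp
  fix t :: nat
  assume "of_int (c_const k) * (real (P_DP (cycle_graph (2 * m + 2)) (k + 2)) / (real k + 2)) ^ k \<le> real t"
  then have t: "of_int (c_const k) * (real (P_DP (cycle_graph n) (k + 2)) / (real k + 2)) ^ k \<le> real t"
    by (simp only: n_def)
  \<comment> \<open>\<open>Base\<close> holds the colorings with start label \<open>0\<close>, and
    each start label accounts for the same share of the minimum. Hence \<open>card Base\<close> is
    the quotient in the bound on \<open>t\<close>.\<close>
  have "q * int (card Base) = int (P_DP (cycle_graph n) (k + 2))"
    unfolding P Base_def \<sigma>_def q_def using n by (intro card_twisted_cycle_colorings) auto
  then have "int ((k + 2) * card Base) = int (P_DP (cycle_graph n) (k + 2))"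
    by (simp only: q_def of_nat_mult)
  then have "(k + 2) * card Base = P_DP (cycle_graph n) (k + 2)" by (simp only: of_nat_eq_iff)
  then have "real (P_DP (cycle_graph n) (k + 2)) = (real k + 2) * real (card Base)"
    by (metis of_nat_add of_nat_mult of_nat_numeral)
  then have "real (P_DP (cycle_graph n) (k + 2)) / (real k + 2) = real (card Base)" by simp
  then have "of_int (c_const k) * real (card Base) ^ k \<le> real t" using t by simp
  \<comment> \<open>Positivity of \<open>c_const k\<close> ensures that \<open>nat\<close> does not
    truncate.\<close>
  moreover have "real (nat (c_const k) * card Base ^ k) = of_int (c_const k) * real (card Base) ^ k"
    using c_const_bounds(1)[OF assms(1)] by simp
  ultimately have "real (nat (c_const k) * card Base ^ k) \<le> real t" by linarith
  then have "nat (c_const k) * card Base ^ k \<le> t" by (simp only: of_nat_le_iff)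
  from box_has_uncolorable_labelling[OF assms(1) n(1,3) this[unfolded Base_def \<sigma>_def q_def]]
  obtain d where d: "labelled_colorings (cycle_graph n \<box> complete_bipartite k t) {0..<q}
      (box_arc n) (box_map n q d) = {}"
    unfolding q_def by blast
  let ?G = "cycle_graph n \<box> complete_bipartite k t"
  have "chi_DP ?G = k + 3"
    unfolding chi_DP_def
  proof (rule Least_equality)
    have G: "simple_graph ?G"
      using orientation_box[OF n(2)] by (rule orientation.simple)
    show "0 < k + 3 \<and> (\<forall>(L :: nat \<times> (nat + nat) \<Rightarrow> nat set) H.
        is_fold_cover (k + 3) ?G L H \<longrightarrow> cover_colorings ?G H \<noteq> {})"
      by (intro conjI allI impI degenerate_cover_coloring[OF G cycle_box_complete_bipartite_degenerate]) simp_all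
  next
    fix y
    assume y: "0 < y \<and> (\<forall>(L :: nat \<times> (nat + nat) \<Rightarrow> nat set) H.
        is_fold_cover y ?G L H \<longrightarrow> cover_colorings ?G H \<noteq> {})"
    show "k + 3 \<le> y"
    proof (rule ccontr)
      assume "\<not> k + 3 \<le> y"
      then have "y \<le> k + 2" by simp
      moreover have "inj_on (box_map n q d a b) {0..<int (k + 2)}" for a b
        using bij_betw_box_map[of q n d a b] by (simp add: bij_betw_def q_def)
      ultimately obtain L :: "nat \<times> (nat + nat) \<Rightarrow> nat set" and H
        where "is_fold_cover y ?G L H" "cover_colorings ?G H = {}"
        using uncolorable_labelling_restrict[OF orientation_box[OF n(2)] _ _ _ d[unfolded q_def]] y
        by (metis q_def)
      then show False using y by blast
    qed
  qed
  then show "chi_DP (cycle_graph (2 * m + 2) \<box> complete_bipartite k t) = k + 3"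
    by (simp only: n_def)
qed

end
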